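(* Let $\varepsilon>0$ be fixed (small). There exists $x_0=x_0(\varepsilon)$ such that for every real $x\ge x_0$ and every real $y\ge x/(\log x)^{1-\varepsilon}$, the interval $[x,x+y]$ contains at least one prime number.
   Context: $\log$ denotes the natural logarithm. *)

theory Defs
  imports "HOL-Analysis.Analysis" "HOL-Computational_Algebra.Primes"
begin

end

theory Submission
  imports Defs "HOL-Number_Theory.Prime_Powers" "HOL-Probability.Probability" "HOL-Real_Asymp.Real_Asymp"
begin

text \<open>
  Write \<open>\<zeta>\<close> for the zeta function and \<open>L = - \<zeta>' / \<zeta>\<close> for the Dirichlet series of \<open>\<Lambda>\<close>. All work is done
  in the half-plane \<open>Re s > 1\<close>, with bounds that are uniform up to its boundary. There
  \<open>\<Sum>n. ln n ^ k * n powr (- s)\<close> differs from \<open>k! / (s - 1) ^ (k + 1)\<close> by \<open>O((4 + \<bar>Im s\<bar>) powr \<theta>)\<close> for every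
  \<open>\<theta> > 0\<close>, and the inequality \<open>3 + 4 cos x + cos 2 x \<ge> 0\<close> turns this into a lower bound for
  \<open>(s - 1) \<zeta>(s)\<close>. Hence the derivative of \<open>L - \<zeta>\<close> is \<open>O((4 + \<bar>Im s\<bar>) powr p)\<close> for every \<open>p > 0\<close>.

  Averaging that derivative over the line \<open>Re s = 1 + 1 / l\<close>, \<open>l = ln x\<close>, against a normal distribution
  gives the sum of \<open>(\<Lambda> n - 1) ln n / n powr (1 + 1 / l)\<close> over \<open>n\<close>, with a Gaussian weight of width
  \<open>\<eta> = l powr (- (1 - \<epsilon> / 2))\<close> in \<open>ln n\<close> that is centred inside the interval of length about
  \<open>\<delta> = l powr (- (1 - \<epsilon>))\<close> in which \<open>ln p\<close> is sought. With \<open>p = \<epsilon> / 4\<close> this sum is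
  \<open>O(\<eta> powr (- p)) = O(l powr (\<epsilon> / 4))\<close>, while the part coming from the \<open>1\<close> is at least a constant
  times \<open>l \<eta> = l powr (\<epsilon> / 2)\<close>. Without a prime in the interval, the part coming from \<open>\<Lambda>\<close> would be
  negligible: outside, the weight is at most \<open>exp (- (l powr \<epsilon>) / 32)\<close>, and inside, proper prime powers are rare.
\<close>

section \<open>Dirichlet series\<close>

text \<open>Since \<open>0 powr z = 0\<close>, the term at \<open>n = 0\<close> vanishes, so the
  usual series over positive integers can be a sum over all naturals.\<close>

definition dser :: "(nat \<Rightarrow> real) \<Rightarrow> complex \<Rightarrow> complex" where
  "dser a s = (\<Sum>n. of_real (a n) * of_nat n powr (- s))"

text \<open>Absolute convergence in the whole half-plane Re s > 1; real exponents suffice, because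
  by \<open>norm_nat_powr\<close> only the real part matters.\<close>

definition abs_conv :: "(nat \<Rightarrow> real) \<Rightarrow> bool" where
  "abs_conv a \<longleftrightarrow> (\<forall>\<sigma>>1. summable (\<lambda>n. \<bar>a n\<bar> * real n powr (- \<sigma>)))"

lemma norm_nat_powr: "norm (of_nat n powr s :: complex) = real n powr Re s"
  using norm_powr_real_powr[of "of_nat n" s] by simp

lemma norm_dser_term:
  "norm (of_real (a n) * of_nat n powr (- s) :: complex) = \<bar>a n\<bar> * real n powr (- Re s)"
  by (simp add: norm_mult norm_nat_powr)

lemma summable_ln_power_powr:
  assumes "\<sigma> > 1"
  shows "summable (\<lambda>n. ln (real n) ^ k * real n powr (- \<sigma>))"
proof (rule summable_comparison_test_ev)
  \<comment> \<open>Half of the excess over 1 absorbs the logarithms, the other half keeps the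
    series convergent.\<close>
  define \<delta> where "\<delta> = (\<sigma> - 1) / 2"
  have \<delta>: "\<delta> > 0" "\<sigma> = 1 + 2 * \<delta>" using assms by (auto simp: \<delta>_def field_simps)
  show "summable (\<lambda>n. real n powr (- 1 - \<delta>))"
    using \<delta> by (simp add: summable_real_powr_iff)
  have "eventually (\<lambda>n. ln (real n) ^ k \<le> real n powr \<delta>) at_top"
    using \<delta> by real_asymp
  then show "\<forall>\<^sub>F n in sequentially. norm (ln (real n) ^ k * real n powr (- \<sigma>)) \<le> real n powr (- 1 - \<delta>)"
    using eventually_ge_at_top[of 1]
  proof eventually_elim
    case (elim n)
    have "norm (ln (real n) ^ k * real n powr (- \<sigma>)) = ln (real n) ^ k * real n powr (- \<sigma>)"
      using elim by (simp add: abs_mult)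
    also have "\<dots> \<le> real n powr \<delta> * real n powr (- \<sigma>)"
      using elim by (intro mult_right_mono) auto
    also have "\<dots> = real n powr (- 1 - \<delta>)"
    proof -
      have "\<delta> + - \<sigma> = - 1 - \<delta>" using \<delta>(2) by simp
      then show ?thesis by (simp only: powr_add [symmetric])
    qed
    finally show ?case .
  qed
qed

lemma abs_conv_ln_power: "abs_conv (\<lambda>n. ln (real n) ^ k)"
  unfolding abs_conv_def
proof safe
  fix \<sigma> :: real assume "\<sigma> > 1"
  moreover have "\<bar>ln (real n) ^ k\<bar> = ln (real n) ^ k" for n
    by (cases n) auto
  ultimately show "summable (\<lambda>n. \<bar>ln (real n) ^ k\<bar> * real n powr (- \<sigma>))"
    using summable_ln_power_powr by simp
qed

lemma abs_conv_ln_power_bound: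
  assumes "\<And>n. \<bar>a n\<bar> \<le> C * ln (real n) ^ k"
  shows "abs_conv a"
  unfolding abs_conv_def
proof safe
  fix \<sigma> :: real assume "\<sigma> > 1"
  then have "summable (\<lambda>n. C * (ln (real n) ^ k * real n powr (- \<sigma>)))"
    by (intro summable_mult summable_ln_power_powr)
  then show "summable (\<lambda>n. \<bar>a n\<bar> * real n powr (- \<sigma>))"
    by (rule summable_comparison_test'[of _ 0])
       (use assms in \<open>auto simp: abs_mult mult.assoc [symmetric] intro!: mult_right_mono\<close>)
qed

lemma abs_conv_diff:
  assumes "abs_conv a" "abs_conv b"
  shows "abs_conv (\<lambda>n. a n - b n)"
  unfolding abs_conv_def
proof safe
  fix \<sigma> :: real assume "\<sigma> > 1"
  then have "summable (\<lambda>n. \<bar>a n\<bar> * real n powr (- \<sigma>) + \<bar>b n\<bar> * real n powr (- \<sigma>))"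
    using assms by (intro summable_add) (auto simp: abs_conv_def)
  then show "summable (\<lambda>n. \<bar>a n - b n\<bar> * real n powr (- \<sigma>))"
    by (rule summable_comparison_test'[of _ 0])
       (auto simp: abs_mult simp flip: distrib_right intro!: mult_right_mono abs_triangle_ineq4)
qed

lemma summable_norm_dser:
  assumes "abs_conv a" "Re s > 1"
  shows "summable (\<lambda>n. norm (of_real (a n) * of_nat n powr (- s) :: complex))"
  using assms unfolding norm_dser_term abs_conv_def by simp

lemma sums_dser:
  assumes "abs_conv a" "Re s > 1"
  shows "(\<lambda>n. of_real (a n) * of_nat n powr (- s)) sums dser a s"
  unfolding dser_def by (rule summable_sums[OF summable_norm_cancel[OF summable_norm_dser[OF assms]]])

lemma dser_diff:
  assumes "abs_conv a" "abs_conv b" "Re s > 1"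
  shows "dser (\<lambda>n. a n - b n) s = dser a s - dser b s"
  using sums_diff[OF sums_dser[OF assms(1,3)] sums_dser[OF assms(2,3)]]
  by (simp add: dser_def sums_iff ring_distribs)

lemma has_sum_dser:
  assumes "abs_conv a" "Re s > 1"
  shows "((\<lambda>n. of_real (a n) * of_nat n powr (- s)) has_sum dser a s) {0<..}"
proof -
  have "((\<lambda>n. of_real (a n) * of_nat n powr (- s)) has_sum dser a s) UNIV"
    using norm_summable_imp_has_sum[OF summable_norm_dser sums_dser] assms by blast
  then show ?thesis
    by (subst has_sum_cong_neutral[where T = UNIV]) auto
qed

lemma abs_summable_dser:
  assumes "abs_conv a" "Re s > 1"
  shows "(\<lambda>n. norm (of_real (a n) * of_nat n powr (- s) :: complex)) summable_on {0<..}"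
proof -
  have "(\<lambda>n. norm (of_real (a n) * of_nat n powr (- s) :: complex)) summable_on UNIV"
    by (rule norm_summable_imp_summable_on) (use summable_norm_dser[OF assms] in simp)
  then show ?thesis
    by (rule summable_on_subset_banach) auto
qed

text \<open>Absolute convergence of the double series over pairs \<open>(d, e)\<close> allows
  regrouping by \<open>n = d * e\<close>. Positive indices make this a bijection onto the pairs
  \<open>(n, d)\<close> with \<open>d dvd n\<close>, and keep the divisor sums finite.\<close>

lemma dser_mult:
  assumes a: "abs_conv a" and b: "abs_conv b" and s: "Re s > 1"
  shows "dser a s * dser b s = dser (\<lambda>n. \<Sum>d | d dvd n. a d * b (n div d)) s"
proof -
  define f where "f n = of_real (a n) * of_nat n powr (- s)" for n
  define g where "g n = of_real (b n) * of_nat n powr (- s)" for n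
  define c where "c n = (\<Sum>d | d dvd n. a d * b (n div d))" for n
  have f: "(f has_sum dser a s) {0<..}" and g: "(g has_sum dser b s) {0<..}"
    unfolding f_def g_def by (intro has_sum_dser a b s)+
  have f': "(\<lambda>n. norm (f n)) summable_on {0<..}" and g': "(\<lambda>n. norm (g n)) summable_on {0<..}"
    unfolding f_def g_def by (intro abs_summable_dser a b s)+
  have "(\<lambda>z. norm ((\<lambda>(x,y). f x * g y) z)) summable_on ({0<..} \<times> {0<..})"
    unfolding Infinite_Sum.abs_summable_on_Sigma_iff
    using summable_on_cmult_right[OF g'] summable_on_cmult_left[OF f']
    by (simp add: norm_mult infsum_cmult_right' infsum_nonneg)
  then have "(\<lambda>(x,y). f x * g y) summable_on {0<..} \<times> {0<..}"
    by (rule abs_summable_summable)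
  then obtain S where S: "((\<lambda>(x,y). f x * g y) has_sum S) ({0<..} \<times> {0<..})"
    by (auto simp: summable_on_def)
  have "((\<lambda>x. f x * dser b s) has_sum S) {0<..}"
    by (rule has_sum_Sigma'[OF S]) (use g in \<open>auto intro!: has_sum_cmult_right\<close>)
  moreover have "((\<lambda>x. f x * dser b s) has_sum (dser a s * dser b s)) {0<..}"
    by (intro has_sum_cmult_left f)
  ultimately have S_eq: "S = dser a s * dser b s"
    using has_sum_unique by blast
  have "((\<lambda>(n,d). f d * g (n div d)) has_sum S) (SIGMA n:{0<..}. {d. d dvd n})"
    (is "(?h has_sum S) ?S")
  proof -
    have "(?h has_sum S) ?S \<longleftrightarrow> ((\<lambda>(x,y). f x * g y) has_sum S) ({0<..} \<times> {0<..})"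
      by (rule has_sum_reindex_bij_witness[where i = "\<lambda>(d,e). (d*e, d)" and j = "\<lambda>(n,d). (d, n div d)"])
         (auto dest: dvd_pos_nat simp: div_greater_zero_iff dvd_imp_le)
    with S show ?thesis by blast
  qed
  then have "((\<lambda>n. \<Sum>d | d dvd n. f d * g (n div d)) has_sum S) {0<..}"
    by (rule has_sum_Sigma') (auto intro!: has_sum_finite)
  also have "?this \<longleftrightarrow> ((\<lambda>n. of_real (c n) * of_nat n powr (- s)) has_sum S) {0<..}"
  proof (rule has_sum_cong)
    fix n :: nat assume "n \<in> {0<..}"
    have "f d * g (n div d) = of_real (a d * b (n div d)) * of_nat n powr (- s)" if d: "d dvd n" for d
    proof -
      obtain e where e: "n = d * e" using d by (rule dvdE)
      show ?thesis using \<open>n \<in> {0<..}\<close> e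
        by (simp add: f_def g_def powr_times_real_left powr_times_real)
    qed
    then show "(\<Sum>d | d dvd n. f d * g (n div d)) = of_real (c n) * of_nat n powr (- s)"
      by (simp add: c_def sum_distrib_right)
  qed
  also have "\<dots> \<longleftrightarrow> ((\<lambda>n. of_real (c n) * of_nat n powr (- s)) has_sum S) UNIV"
    by (rule has_sum_cong_neutral) auto
  finally have "(\<lambda>n. of_real (c n) * of_nat n powr (- s)) sums S"
    by (rule has_sum_imp_sums)
  then show ?thesis
    unfolding S_eq by (simp add: dser_def sums_iff c_def)
qed

lemma has_field_derivative_dser:
  assumes "abs_conv a" "abs_conv (\<lambda>n. a n * ln (real n))" "Re s > 1"
  shows "(dser a has_field_derivative - dser (\<lambda>n. a n * ln (real n)) s) (at s)"
proof -
  \<comment> \<open>The M-test needs a majorant on a neighbourhood of \<open>s\<close> that stays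
    away from the line Re s = 1; the midpoint gives one.\<close>
  define \<sigma> where "\<sigma> = (1 + Re s) / 2"
  have \<sigma>: "\<sigma> > 1" "\<sigma> < Re s" using assms by (auto simp: \<sigma>_def)
  define f' where "f' n x = - (of_real (a n * ln (real n)) * of_nat n powr (- x) :: complex)" for n x
  define S where "S = {x. Re x \<ge> \<sigma>}"
  have "((\<lambda>x. \<Sum>n. of_real (a n) * of_nat n powr (- x)) has_field_derivative (\<Sum>n. f' n s)) (at s)"
  proof (rule has_field_derivative_series')
    show "convex S" unfolding S_def by (rule convex_halfspace_Re_ge)
    show "((\<lambda>x. of_real (a n) * of_nat n powr (- x)) has_field_derivative f' n x) (at x within S)" for n x
    proof (cases "n = 0")
      case False
      have "((\<lambda>x. of_nat n powr (- x)) has_field_derivative (Ln (of_nat n) * of_nat n powr (- x)) * (- 1)) (at x within S)"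
        using False by (intro DERIV_chain2[OF has_field_derivative_powr_right] derivative_eq_intros) auto
      from DERIV_cmult[OF this, of "of_real (a n)"] show ?thesis
        using False by (simp add: f'_def mult_ac)
    qed (auto simp: f'_def)
    show "uniformly_convergent_on S (\<lambda>n x. \<Sum>i<n. f' i x)"
    proof (rule Weierstrass_m_test')
      show "summable (\<lambda>n. \<bar>a n * ln (real n)\<bar> * real n powr (- \<sigma>))"
        using assms \<sigma> by (simp add: abs_conv_def)
      show "norm (f' n x) \<le> \<bar>a n * ln (real n)\<bar> * real n powr (- \<sigma>)" if "x \<in> S" for n x
      proof -
        have "norm (f' n x) = \<bar>a n * ln (real n)\<bar> * real n powr (- Re x)"
          unfolding f'_def norm_minus_cancel by (rule norm_dser_term)
        also have "\<dots> \<le> \<bar>a n * ln (real n)\<bar> * real n powr (- \<sigma>)"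
          using that by (cases "n = 0") (auto simp: S_def intro!: mult_left_mono powr_mono)
        finally show ?thesis .
      qed
    qed
    show "s \<in> S" using \<sigma> by (simp add: S_def)
    show "summable (\<lambda>n. of_real (a n) * of_nat n powr (- s) :: complex)"
      using sums_dser[OF assms(1,3)] by (rule sums_summable)
    have "open {x. Re x > \<sigma>}" by (rule open_halfspace_Re_gt)
    then show "s \<in> interior S"
      using \<sigma> by (intro interiorI[of "{x. Re x > \<sigma>}"]) (auto simp: S_def)
  qed
  also have "(\<lambda>x. \<Sum>n. of_real (a n) * of_nat n powr (- x)) = dser a"
    by (simp add: dser_def fun_eq_iff)
  also have "(\<Sum>n. f' n s) = - dser (\<lambda>n. a n * ln (real n)) s"
    using sums_minus[OF sums_dser[OF assms(2,3)]] by (simp add: f'_def sums_iff)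
  finally show ?thesis .
qed

section \<open>The von Mangoldt series and its relation to zeta\<close>

abbreviation \<Lambda> :: "nat \<Rightarrow> real" where "\<Lambda> \<equiv> mangoldt"

text \<open>This is (-1)^k times the k-th derivative of zeta; the sign makes all coefficients
  non-negative.\<close>

abbreviation zeta_log :: "nat \<Rightarrow> complex \<Rightarrow> complex" where
  "zeta_log k \<equiv> dser (\<lambda>n. ln (real n) ^ k)"

lemma ln_nat_nonneg: "ln (real n) \<ge> 0"
  by (cases n) auto

lemma mangoldt_le_ln: "\<Lambda> n \<le> ln (real n)"
proof (cases "primepow n")
  case True
  then have n: "n > 0" "n \<noteq> 1" by (auto intro: primepow_gt_0_nat)
  then have "aprimedivisor n dvd n" "prime (aprimedivisor n)"
    using aprimedivisor_nat[of n] by auto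
  then show ?thesis using n True
    by (auto simp: mangoldt_def intro!: ln_mono dvd_imp_le prime_gt_0_nat)
qed (auto simp: mangoldt_def ln_nat_nonneg)

lemma abs_conv_mangoldt: "abs_conv \<Lambda>"
  by (rule abs_conv_ln_power_bound[of _ 1 1])
     (use mangoldt_le_ln in \<open>auto simp: mangoldt_nonneg\<close>)

lemma abs_conv_mangoldt_ln: "abs_conv (\<lambda>n. \<Lambda> n * ln (real n))"
  by (rule abs_conv_ln_power_bound[of _ 1 2])
     (use mangoldt_le_ln in \<open>auto simp: abs_mult ln_nat_nonneg power2_eq_square intro!: mult_right_mono\<close>)

text \<open>The divisor sum \<open>mangoldt_sum\<close> turned into series:
  \<open>dser \<Lambda>\<close> is the negative logarithmic derivative of zeta, in a form without
  division.\<close>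

lemma dser_mangoldt_mult_zeta:
  assumes "Re s > 1"
  shows "dser \<Lambda> s * zeta_log 0 s = zeta_log 1 s"
proof -
  have "dser \<Lambda> s * zeta_log 0 s = dser (\<lambda>n. \<Sum>d | d dvd n. \<Lambda> d * 1) s"
    by (subst dser_mult) (use assms abs_conv_mangoldt abs_conv_ln_power[of 0] in auto)
  also have "\<dots> = zeta_log 1 s"
    unfolding dser_def
  proof (intro suminf_cong)
    show "of_real (\<Sum>d | d dvd n. \<Lambda> d * 1) * of_nat n powr (- s) =
            of_real (ln (real n) ^ 1) * (of_nat n powr (- s) :: complex)" for n
      using mangoldt_sum[of n, where 'a = real] by (cases "n = 0") auto
  qed
  finally show ?thesis .
qed

text \<open>The derivative of \<open>dser_mangoldt_mult_zeta\<close>, computed from both sides. It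
  ties the series of \<open>\<Lambda> n * ln (real n)\<close> to zeta and its first two
  derivatives.\<close>

lemma dser_mangoldt_ln_mult_zeta:
  assumes s: "Re s > 1"
  shows "dser (\<lambda>n. \<Lambda> n * ln (real n)) s * zeta_log 0 s + dser \<Lambda> s * zeta_log 1 s = zeta_log 2 s"
proof -
  have 1: "abs_conv (\<lambda>n. ln (real n) * ln (real n))"
    using abs_conv_ln_power[of 2] by (simp add: power2_eq_square)
  have 0: "abs_conv (\<lambda>n. 1)" "abs_conv (\<lambda>n. ln (real n))"
    using abs_conv_ln_power[of 0] abs_conv_ln_power[of 1] by simp_all
  have D: "((\<lambda>s. dser \<Lambda> s * zeta_log 0 s) has_field_derivative
      - dser (\<lambda>n. \<Lambda> n * ln (real n)) s * zeta_log 0 s + - zeta_log 1 s * dser \<Lambda> s) (at s)"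
    using DERIV_mult[OF has_field_derivative_dser[OF abs_conv_mangoldt abs_conv_mangoldt_ln s]
        has_field_derivative_dser[of "\<lambda>_. 1" s]] 0 s by (simp add: add_ac)
  have "((\<lambda>s. dser \<Lambda> s * zeta_log 0 s) has_field_derivative - zeta_log 2 s) (at s)"
  proof -
    have "\<forall>\<^sub>F x in nhds s. x \<in> {x. Re x > 1}"
      using s by (intro eventually_nhds_in_open open_halfspace_Re_gt) auto
    then have "\<forall>\<^sub>F x in nhds s. dser \<Lambda> x * zeta_log 0 x = zeta_log 1 x"
      by eventually_elim (use dser_mangoldt_mult_zeta in auto)
    moreover have "(zeta_log 1 has_field_derivative - zeta_log 2 s) (at s)"
      using has_field_derivative_dser[of "\<lambda>n. ln (real n)" s] s 0 1 by (simp add: power2_eq_square)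
    ultimately show ?thesis
      by (subst DERIV_cong_ev[OF refl _ refl])
  qed
  from DERIV_unique[OF this D] show ?thesis
    unfolding minus_mult_left [symmetric] minus_add_distrib [symmetric] neg_equal_iff_equal
    by (simp only: mult.commute)
qed

section \<open>Zeta and its derivatives near the line \<open>Re s = 1\<close>\<close>

text \<open>An antiderivative of \<open>Ln z ^ k * z powr (- w - 1)\<close>; the recursion is
  integration by parts. With \<open>w = s - 1\<close> the integrand is the summand of
  \<open>zeta_log k s\<close>.\<close>

fun ln_power_prim :: "nat \<Rightarrow> complex \<Rightarrow> complex \<Rightarrow> complex" where
  "ln_power_prim 0 w z = - (z powr (- w)) / w"
| "ln_power_prim (Suc k) w z =
     (of_nat (Suc k) * ln_power_prim k w z - Ln z ^ Suc k * z powr (- w)) / w"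

lemma has_field_derivative_ln_power_prim:
  assumes "z \<notin> \<real>\<^sub>\<le>\<^sub>0" "w \<noteq> 0"
  shows "(ln_power_prim k w has_field_derivative Ln z ^ k * z powr (- w - 1)) (at z)"
proof (induction k)
  case 0
  have "((\<lambda>z. - (z powr (- w)) / w) has_field_derivative z powr (- w - 1)) (at z)"
    using assms by (auto intro!: derivative_eq_intros)
  then show ?case by simp
next
  case (Suc k)
  have z: "z \<noteq> 0" using assms by auto
  have eq: "z powr (- w - 1) = z powr (- w) / z" using z by (simp add: powr_diff)
  have "((\<lambda>z. (of_nat (Suc k) * ln_power_prim k w z - Ln z ^ Suc k * z powr (- w)) / w)
     has_field_derivative (of_nat (Suc k) * (Ln z ^ k * z powr (- w - 1)) -
        (of_nat (Suc k) * (Ln z ^ k * inverse z) * z powr (- w) + (- w * z powr (- w - 1)) * Ln z ^ Suc k)) / w) (at z)"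
  proof (intro DERIV_cdivide DERIV_diff DERIV_cmult DERIV_mult Suc)
    show "((\<lambda>z. Ln z ^ Suc k) has_field_derivative of_nat (Suc k) * (Ln z ^ k * inverse z)) (at z)"
      using DERIV_power[OF has_field_derivative_Ln[OF assms(1)], of "Suc k"] by (simp add: mult_ac)
    show "((\<lambda>z. z powr (- w)) has_field_derivative - w * z powr (- w - 1)) (at z)"
      using assms by (auto intro!: derivative_eq_intros)
  qed
  also have "(of_nat (Suc k) * (Ln z ^ k * z powr (- w - 1)) -
        (of_nat (Suc k) * (Ln z ^ k * inverse z) * z powr (- w) + (- w * z powr (- w - 1)) * Ln z ^ Suc k)) / w
        = Ln z ^ Suc k * z powr (- w - 1)"
    unfolding eq using assms z by (simp add: field_simps)
  finally show ?case by simp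
qed

text \<open>Together with the limit 0 at infinity, this value makes the integral over z \<ge> 1
  equal to \<open>fact k / w ^ Suc k\<close>, the polar part of \<open>zeta_log k\<close>.\<close>

lemma ln_power_prim_1: "ln_power_prim k w 1 = - (fact k / w ^ Suc k)"
  by (induction k) (simp_all add: ring_distribs add_divide_distrib diff_divide_distrib mult_ac)

lemma ln_power_prim_tendsto_0:
  assumes "Re w > 0"
  shows "(\<lambda>n. ln_power_prim k w (of_nat (Suc n))) \<longlonglongrightarrow> 0"
proof (induction k)
  have *: "(\<lambda>n. Ln (of_nat (Suc n)) ^ k * of_nat (Suc n) powr (- w)) \<longlonglongrightarrow> 0" for k
  proof (rule tendsto_norm_zero_cancel)
    have "(\<lambda>n. ln (real (Suc n)) ^ k * real (Suc n) powr (- Re w)) \<longlonglongrightarrow> 0"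
      using assms by real_asymp
    also have "(\<lambda>n. ln (real (Suc n)) ^ k * real (Suc n) powr (- Re w)) =
       (\<lambda>n. norm (Ln (of_nat (Suc n)) ^ k * of_nat (Suc n) powr (- w)))"
      unfolding norm_mult norm_nat_powr norm_power Ln_of_nat[OF zero_less_Suc]
      by (simp add: ln_nat_nonneg del: of_nat_Suc)
    finally show "(\<lambda>n. norm (Ln (of_nat (Suc n)) ^ k * of_nat (Suc n) powr (- w))) \<longlonglongrightarrow> 0" .
  qed
  have w: "w \<noteq> 0" using assms by auto
  {
    case 0
    show ?case using tendsto_divide[OF tendsto_minus[OF *[of 0]] tendsto_const w]
      by (simp del: of_nat_Suc)
  next
    case (Suc k)
    have "(\<lambda>n. (of_nat (Suc k) * ln_power_prim k w (of_nat (Suc n)) - Ln (of_nat (Suc n)) ^ Suc k * of_nat (Suc n) powr (- w)) / w)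
            \<longlonglongrightarrow> (of_nat (Suc k) * 0 - 0) / w"
      by (intro tendsto_intros Suc * w)
    then show ?case by (simp only: ln_power_prim.simps) simp
  }
qed

text \<open>The trivial bound and the mean value bound for the \<open>n\<close>-th term are interpolated with
  exponent \<open>\<theta>\<close>, which is what makes the dependence on \<open>s\<close> as weak as desired.\<close>

lemma ln_power_term_bound:
  fixes s :: complex
  assumes s: "Re s > 1" and n: "n > 0" and \<theta>: "0 < \<theta>" "\<theta> \<le> 1"
  shows "norm (Ln (of_nat n) ^ k * of_nat n powr (- s) -
           (ln_power_prim k (s - 1) (of_nat (Suc n)) - ln_power_prim k (s - 1) (of_nat n)))
         \<le> 2 * (1 + ln (real (Suc n))) ^ k * real n powr (- 1 - \<theta>) * (real k + norm s) powr \<theta>"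
proof -
  define g where "g z = Ln z ^ k * z powr (- s)" for z :: complex
  define g' where "g' z = (of_nat k * Ln z ^ (k - 1) - s * Ln z ^ k) * z powr (- s - 1)" for z :: complex
  define S where "S = closed_segment (of_nat n :: complex) (of_nat (Suc n))"
  define L where "L = 1 + ln (real (Suc n))"
  define A where "A = real k + norm s"
  have "norm s > 1" using s complex_Re_le_cmod[of s] by linarith
  then have A: "A > 1" by (simp add: A_def)
  have L: "L \<ge> 1" by (simp add: L_def)
  have S_real: "\<exists>u. z = of_real u \<and> real n \<le> u \<and> u \<le> real (Suc n)" if "z \<in> S" for z
  proof -
    from that obtain t where t: "0 \<le> t" "t \<le> 1" "z = (1 - t) *\<^sub>R of_nat n + t *\<^sub>R of_nat (Suc n)"
      unfolding S_def closed_segment_def by auto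
    have "z = of_real (real n + t)" unfolding t by (simp add: algebra_simps scaleR_conv_of_real)
    with t show ?thesis by (intro exI[of _ "real n + t"]) auto
  qed
  have nin: "of_nat n \<in> S" "of_nat (Suc n) \<in> S" by (auto simp: S_def)
  have pw: "norm (z powr (- s - of_nat j)) \<le> real n powr (- 1 - real j)" if "z \<in> S" for z j
  proof -
    obtain u where u: "z = of_real u" "real n \<le> u" using S_real[OF \<open>z \<in> S\<close>] by auto
    have "norm (z powr (- s - of_nat j)) = u powr (- Re s - real j)"
      using norm_powr_real_powr[of "of_real u" "- s - of_nat j"] u n by simp
    also have "\<dots> \<le> real n powr (- Re s - real j)"
      using u n s by (intro powr_mono2') auto
    also have "\<dots> \<le> real n powr (- 1 - real j)"
      using n s by (intro powr_mono) auto
    finally show ?thesis .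
  qed
  have Lnb: "norm (Ln z) \<le> L" "norm (Ln z ^ j) \<le> L ^ j" if "z \<in> S" for z j
  proof -
    obtain u where u: "z = of_real u" "real n \<le> u" "u \<le> real (Suc n)" using S_real[OF \<open>z \<in> S\<close>] by auto
    have u1: "u \<ge> 1" using u n by linarith
    have "Ln z = of_real (ln u)" using u u1 by (simp add: Ln_of_real)
    then have "norm (Ln z) = ln u" using u1 by simp
    also have "\<dots> \<le> ln (real (Suc n))" using u u1 by (intro ln_mono) auto
    finally show "norm (Ln z) \<le> L" by (simp add: L_def)
    then show "norm (Ln z ^ j) \<le> L ^ j" by (simp add: norm_power power_mono)
  qed
  have znr: "z \<notin> \<real>\<^sub>\<le>\<^sub>0" if "z \<in> S" for z
    using S_real[OF that] n by (auto simp: complex_nonpos_Reals_iff)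
  have g_bound: "norm (g z) \<le> L ^ k * real n powr (- 1)" if "z \<in> S" for z
    using mult_mono[OF Lnb(2)[OF that, of k] pw[OF that, of 0]] L by (simp add: g_def norm_mult)
  have g'_bound: "norm (g' z) \<le> A * L ^ k * real n powr (- 2)" if "z \<in> S" for z
  proof -
    have "norm (of_nat k * Ln z ^ (k - 1) - s * Ln z ^ k) \<le> real k * L ^ (k - 1) + norm s * L ^ k"
      using Lnb(2)[OF that]
      by (intro order_trans[OF norm_triangle_ineq4] add_mono) (auto simp: norm_mult intro!: mult_left_mono)
    also have "\<dots> \<le> real k * L ^ k + norm s * L ^ k"
      using L by (intro add_mono mult_left_mono power_increasing) auto
    also have "\<dots> = A * L ^ k" by (simp add: A_def ring_distribs)
    finally show ?thesis
      unfolding g'_def norm_mult using pw[OF that, of 1] L A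
      by (intro mult_mono) auto
  qed
  have dg: "(g has_field_derivative g' z) (at z)" if "z \<in> S" for z
  proof -
    have "z \<noteq> 0" using znr[OF that] by auto
    then have eq: "z powr (- s - 1) = z powr (- s) / z" by (simp add: powr_diff)
    show ?thesis unfolding g_def g'_def eq using znr[OF that] \<open>z \<noteq> 0\<close>
      by (auto intro!: derivative_eq_intros simp: eq divide_simps) (simp add: algebra_simps)
  qed
  have g_diff: "norm (g (of_nat n) - g z) \<le> A * L ^ k * real n powr (- 2)" if "z \<in> S" for z
  proof -
    obtain u where u: "z = of_real u" "real n \<le> u" "u \<le> real (Suc n)" using S_real[OF \<open>z \<in> S\<close>] by auto
    have "norm (g (of_nat n) - g z) \<le> A * L ^ k * real n powr (- 2) * norm (of_nat n - z)"
      using that nin dg g'_bound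
      by (intro field_differentiable_bound[of S g g']) (auto simp: S_def intro: has_field_derivative_at_within)
    also have "norm (of_nat n - z) = \<bar>real n - u\<bar>"
      by (metis norm_of_real of_real_diff of_real_of_nat_eq u(1))
    also have "A * L ^ k * real n powr (- 2) * \<bar>real n - u\<bar> \<le> A * L ^ k * real n powr (- 2) * 1"
      using u A L by (intro mult_left_mono) auto
    finally show ?thesis by simp
  qed
  define B where "B = 2 * L ^ k * real n powr (- 1 - \<theta>) * A powr \<theta>"
  \<comment> \<open>Up to \<open>n = A\<close> the trivial bound 1 / n is the better one, beyond it
    the bound A / n^2 from the derivative. In both ranges A^\<theta> n^(-1-\<theta>) dominates; the
    2 counts the two terms of the trivial bound.\<close>
  have B: "norm (g (of_nat n) - g z) \<le> B" if "z \<in> S" for z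
  proof (cases "A \<le> real n")
    case True
    have "A = A powr \<theta> * A powr (1 - \<theta>)" "real n powr (- 2) = real n powr (- 1 - \<theta>) * real n powr (- (1 - \<theta>))"
      using A by (simp_all flip: powr_add)
    then have "A * L ^ k * real n powr (- 2) = L ^ k * real n powr (- 1 - \<theta>) * (A powr \<theta> * (A powr (1 - \<theta>) * real n powr (- (1 - \<theta>))))"
      by (metis (no_types, opaque_lifting) mult.assoc mult.left_commute)
    also have "A powr (1 - \<theta>) * real n powr (- (1 - \<theta>)) \<le> real n powr (1 - \<theta>) * real n powr (- (1 - \<theta>))"
      using True A \<theta> by (intro mult_right_mono powr_mono2) auto
    also have "\<dots> = 1" using n by (simp flip: powr_add)
    also have "L ^ k * real n powr (- 1 - \<theta>) * (A powr \<theta> * 1) \<le> B"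
      using L A by (simp add: B_def)
    finally have "A * L ^ k * real n powr (- 2) \<le> B"
      using L A by (simp add: mult_left_mono)
    then show ?thesis using g_diff[OF that] by linarith
  next
    case False
    have "norm (g (of_nat n) - g z) \<le> L ^ k * real n powr (- 1) + L ^ k * real n powr (- 1)"
      using nin that by (intro order_trans[OF norm_triangle_ineq4] add_mono g_bound)
    also have "\<dots> = 2 * L ^ k * (real n powr (- 1 - \<theta>) * real n powr \<theta>)"
      using n by (simp flip: powr_add)
    also have "\<dots> \<le> 2 * L ^ k * (real n powr (- 1 - \<theta>) * A powr \<theta>)"
      using False L \<theta> by (intro mult_left_mono powr_mono2) auto
    finally show ?thesis by (simp add: B_def)
  qed
  \<comment> \<open>The increment of \<open>\<phi>\<close> over \<open>[n, n + 1]\<close> is the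
    summand at \<open>n\<close> minus its integral, and its derivative is the difference just
    bounded.\<close>
  define \<phi> where "\<phi> z = g (of_nat n) * z - ln_power_prim k (s - 1) z" for z
  have "s \<noteq> 1" using s by auto
  then have d\<phi>: "(\<phi> has_field_derivative g (of_nat n) - g z) (at z)" if "z \<in> S" for z
    unfolding \<phi>_def using has_field_derivative_ln_power_prim[OF znr[OF that], of "s - 1" k]
    by (auto intro!: derivative_eq_intros simp: g_def)
  have "norm (\<phi> (of_nat (Suc n)) - \<phi> (of_nat n)) \<le> B * norm (of_nat (Suc n) - of_nat n :: complex)"
    using d\<phi> B nin
    by (intro field_differentiable_bound[of S \<phi> "\<lambda>z. g (of_nat n) - g z"])
       (auto simp: S_def intro: has_field_derivative_at_within)
  also have "\<phi> (of_nat (Suc n)) - \<phi> (of_nat n) = g (of_nat n) -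
       (ln_power_prim k (s - 1) (of_nat (Suc n)) - ln_power_prim k (s - 1) (of_nat n))"
    by (simp add: \<phi>_def algebra_simps)
  finally show ?thesis by (simp add: B_def L_def A_def g_def)
qed

text \<open>Sum and integral are compared on each \<open>[n, n + 1]\<close>. The factor
  \<open>n powr (- 1 - \<theta>)\<close> makes the errors summable, while \<open>s\<close> enters
  only through a common factor; the integrals telescope to the polar part.\<close>

lemma zeta_log_bound:
  fixes \<theta> :: real
  assumes \<theta>: "0 < \<theta>" "\<theta> \<le> 1"
  obtains C where "C > 0" "\<And>s. Re s > 1 \<Longrightarrow>
    norm (zeta_log k s - fact k / (s - 1) ^ Suc k) \<le> C * (real k + norm s) powr \<theta>"
proof
  define b where "b n = 2 * (1 + ln (real (Suc (Suc n)))) ^ k * real (Suc n) powr (- 1 - \<theta>)" for n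
  have b_nonneg: "b n \<ge> 0" for n
    unfolding b_def by (intro mult_nonneg_nonneg zero_le_power add_nonneg_nonneg) (auto simp del: of_nat_Suc simp: ln_nat_nonneg)
  have b: "summable b"
  proof (rule summable_comparison_test_ev)
    show "summable (\<lambda>n. real n powr (- 1 - \<theta> / 2))"
      using \<theta> by (simp add: summable_real_powr_iff)
    have "eventually (\<lambda>n. b n \<le> real n powr (- 1 - \<theta> / 2)) at_top"
      unfolding b_def using \<theta> by real_asymp
    then show "\<forall>\<^sub>F n in sequentially. norm (b n) \<le> real n powr (- 1 - \<theta> / 2)"
      using b_nonneg by simp
  qed
  define C where "C = 1 + (\<Sum>n. b n)"
  show "C > 0" using suminf_nonneg[OF b b_nonneg] by (simp add: C_def)
  fix s :: complex assume s: "Re s > 1"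
  define A where "A = real k + norm s"
  define G where "G = (\<lambda>n. ln_power_prim k (s - 1) (of_nat (Suc n)))"
  define D where "D n = Ln (of_nat (Suc n)) ^ k * of_nat (Suc n) powr (- s) - (G (Suc n) - G n)" for n
  have "G \<longlonglongrightarrow> 0" unfolding G_def using s by (intro ln_power_prim_tendsto_0) auto
  from telescope_sums[OF this] have 1: "(\<lambda>n. G (Suc n) - G n) sums (fact k / (s - 1) ^ Suc k)"
    by (simp add: G_def ln_power_prim_1)
  have "(\<lambda>n. of_real (ln (real n) ^ k) * of_nat n powr (- s)) sums zeta_log k s"
    using s by (intro sums_dser abs_conv_ln_power)
  then have "(\<lambda>n. of_real (ln (real (Suc n)) ^ k) * of_nat (Suc n) powr (- s)) sums zeta_log k s"
    by (subst sums_Suc_iff) simp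
  also have "(\<lambda>n. of_real (ln (real (Suc n)) ^ k) * of_nat (Suc n) powr (- s)) =
     (\<lambda>n. Ln (of_nat (Suc n)) ^ k * of_nat (Suc n) powr (- s))"
    unfolding Ln_of_nat[OF zero_less_Suc] by simp
  finally have D: "D sums (zeta_log k s - fact k / (s - 1) ^ Suc k)"
    unfolding D_def using 1 by (intro sums_diff)
  have D_le: "norm (D n) \<le> b n * A powr \<theta>" for n
    unfolding D_def G_def b_def A_def using s \<theta> by (intro ln_power_term_bound) auto
  have bA: "summable (\<lambda>n. b n * A powr \<theta>)" using b by (rule summable_mult2)
  have "norm (zeta_log k s - fact k / (s - 1) ^ Suc k) = norm (\<Sum>n. D n)"
    using D by (simp add: sums_iff)
  also have "\<dots> \<le> (\<Sum>n. b n * A powr \<theta>)"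
    by (rule norm_suminf_le[OF D_le bA])
  also have "\<dots> = (\<Sum>n. b n) * A powr \<theta>" using b by (rule suminf_mult2 [symmetric])
  also have "\<dots> \<le> C * A powr \<theta>" by (intro mult_right_mono) (auto simp: C_def)
  finally show "norm (zeta_log k s - fact k / (s - 1) ^ Suc k) \<le> C * (real k + norm s) powr \<theta>"
    by (simp add: A_def)
qed

section \<open>Lower bounds for zeta\<close>

lemma has_field_derivative_zeta_log:
  assumes "Re s > 1"
  shows "(zeta_log k has_field_derivative - zeta_log (Suc k) s) (at s)"
  using has_field_derivative_dser[of "\<lambda>n. ln (real n) ^ k" s] assms
    abs_conv_ln_power[of k] abs_conv_ln_power[of "Suc k"] by (simp add: mult_ac)

lemma Re_nat_powr:
  assumes "n > 0"
  shows "Re (of_nat n powr (- Complex \<sigma> t)) = real n powr (- \<sigma>) * cos (t * ln (real n))"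
proof -
  have "of_nat n powr (- Complex \<sigma> t) = exp (- Complex \<sigma> t * of_real (ln (real n)))"
    using assms by (simp add: powr_def)
  then show ?thesis using assms by (simp add: Re_exp powr_def mult_ac)
qed

lemma three_four_one_nonneg:
  assumes "\<sigma> > 1"
  shows "0 \<le> Re (3 * dser \<Lambda> (of_real \<sigma>) + 4 * dser \<Lambda> (Complex \<sigma> t) + dser \<Lambda> (Complex \<sigma> (2 * t)))"
proof -
  define T where "T t n = Re (of_real (\<Lambda> n) * of_nat n powr (- Complex \<sigma> t))" for t n
  have T: "T t sums Re (dser \<Lambda> (Complex \<sigma> t))" for t
    unfolding T_def using assms by (intro sums_Re sums_dser abs_conv_mangoldt) auto
  have "(\<lambda>n. 3 * T 0 n + 4 * T t n + T (2 * t) n) sums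
     (3 * Re (dser \<Lambda> (Complex \<sigma> 0)) + 4 * Re (dser \<Lambda> (Complex \<sigma> t)) + Re (dser \<Lambda> (Complex \<sigma> (2 * t))))"
    by (intro sums_add sums_mult T)
  moreover have "3 * T 0 n + 4 * T t n + T (2 * t) n \<ge> 0" for n
  proof (cases "n = 0")
    case False
    define x where "x = t * ln (real n)"
    have "3 * T 0 n + 4 * T t n + T (2 * t) n = \<Lambda> n * (real n powr (- \<sigma>) * (3 + 4 * cos x + cos (2 * x)))"
      using False by (simp add: T_def Re_nat_powr x_def algebra_simps del: mangoldt_def)
    also have "3 + 4 * cos x + cos (2 * x) = 2 * (1 + cos x)\<^sup>2"
      unfolding cos_double_cos by (simp add: power2_eq_square algebra_simps)
    finally show ?thesis by (simp add: mangoldt_nonneg)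
  qed (simp add: T_def)
  ultimately have "0 \<le> 3 * Re (dser \<Lambda> (Complex \<sigma> 0)) + 4 * Re (dser \<Lambda> (Complex \<sigma> t)) + Re (dser \<Lambda> (Complex \<sigma> (2 * t)))"
    by (rule sums_le[OF _ sums_zero, rotated])
  then show ?thesis by (simp add: complex_of_real_def)
qed

text \<open>On this line zeta differs from its first term 1 by at most the sum of 1 / m^2 over m
  \<ge> 2, which is at most 2/3. It is the anchor of the monotonicity argument that follows.\<close>

lemma norm_zeta_line_2:
  assumes "Re s = 2"
  shows "norm (zeta_log 0 s) \<ge> 1 / 3"
proof -
  define f where "f n = (of_nat n :: complex) powr (- s)" for n
  have "f sums zeta_log 0 s"
    using sums_dser[OF abs_conv_ln_power[of 0], of s] assms by (simp add: f_def [abs_def])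
  then have "(\<lambda>n. f (Suc n)) sums zeta_log 0 s"
    by (subst sums_Suc_iff) (simp add: f_def)
  then have 1: "(\<lambda>n. f (Suc (Suc n))) sums (zeta_log 0 s - 1)"
    by (subst sums_Suc_iff) (simp add: f_def)
  \<comment> \<open>Telescoping majorant: 1 / m^2 \<le> 1 / (m - 1/2) - 1 / (m + 1/2) with m = n +
    2, of total 1 / (3/2).\<close>
  define g where "g n = - (1 / (real n + 3 / 2))" for n
  have "g \<longlonglongrightarrow> 0" unfolding g_def by real_asymp
  from telescope_sums[OF this] have 2: "(\<lambda>n. g (Suc n) - g n) sums (2 / 3)" by (simp add: g_def)
  have "norm (f (Suc (Suc n))) \<le> g (Suc n) - g n" for n
  proof -
    have "norm (f (Suc (Suc n))) = 1 / (real n + 2) ^ 2"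
      unfolding f_def norm_nat_powr using assms by (simp add: powr_minus divide_simps powr_numeral add_ac)
    also have "\<dots> \<le> 1 / ((real n + 3 / 2) * (real n + 5 / 2))"
    proof (intro divide_left_mono)
      show "(real n + 3 / 2) * (real n + 5 / 2) \<le> (real n + 2)\<^sup>2"
        by (simp add: power2_eq_square algebra_simps)
    qed (auto intro!: mult_pos_pos)
    also have "\<dots> = g (Suc n) - g n"
      unfolding g_def of_nat_Suc by (simp add: divide_simps)
    finally show ?thesis .
  qed
  then have "norm (\<Sum>n. f (Suc (Suc n))) \<le> (\<Sum>n. g (Suc n) - g n)"
    using 2 by (intro norm_suminf_le) (auto simp: sums_iff)
  then have "norm (zeta_log 0 s - 1) \<le> 2 / 3"
    using 1 2 by (simp add: sums_iff)
  then show ?thesis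
    using norm_triangle_ineq2[of 1 "1 - zeta_log 0 s"] norm_minus_commute[of "zeta_log 0 s" 1] by simp
qed

text \<open>The product is decreasing in \<open>\<sigma>\<close>, since minus its logarithmic derivative has non-negative
  real part; so it is bounded below by its value at \<open>\<sigma> = 2\<close>.\<close>

lemma zeta_three_four_one:
  assumes \<sigma>: "1 < \<sigma>" "\<sigma> \<le> 2"
  shows "norm (zeta_log 0 (of_real \<sigma>)) ^ 3 * norm (zeta_log 0 (Complex \<sigma> t)) ^ 4 *
           norm (zeta_log 0 (Complex \<sigma> (2 * t))) \<ge> 1 / 3 ^ 8"
proof -
  define Z where "Z = zeta_log 0"
  define c where "c = (\<lambda>u::real. \<i> * of_real u)"
  define f where "f z = Z z ^ 3 * Z (z + c t) ^ 4 * Z (z + c (2 * t))" for z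
  define W where "W z = 3 * dser \<Lambda> z + 4 * dser \<Lambda> (z + c t) + dser \<Lambda> (z + c (2 * t))" for z
  have c: "of_real x + c u = Complex x u" for x u by (simp add: c_def complex_eq_iff)
  have dZ: "((\<lambda>z. Z (z + c u)) has_field_derivative - dser \<Lambda> (z + c u) * Z (z + c u)) (at z)" if "Re z > 1" for z u
  proof -
    have "Re (z + c u) > 1" using that by (simp add: c_def)
    from has_field_derivative_zeta_log[OF this, of 0] dser_mangoldt_mult_zeta[OF this]
    have "(Z has_field_derivative - dser \<Lambda> (z + c u) * Z (z + c u)) (at (z + c u))"
      by (simp add: Z_def)
    moreover have "((\<lambda>z. z + c u) has_field_derivative 1) (at z)"
      by (auto intro!: derivative_eq_intros)
    ultimately have "((\<lambda>z. Z (z + c u)) has_field_derivative (- dser \<Lambda> (z + c u) * Z (z + c u)) * 1) (at z)"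
      by (rule DERIV_chain2)
    then show ?thesis by simp
  qed
  have c0: "c 0 = 0" by (simp add: c_def)
  have df: "(f has_field_derivative - W z * f z) (at z)" if "Re z > 1" for z
    unfolding f_def using dZ[OF that, of 0, unfolded c0 add_0_right] dZ[OF that, of t] dZ[OF that, of "2 * t"]
    by (auto intro!: derivative_eq_intros simp: W_def) (simp add: algebra_simps power2_eq_square power3_eq_cube power4_eq_xxxx)
  \<comment> \<open>The squared modulus is differentiable even at zeros of \<open>f\<close>, so no
    non-vanishing has to be known.\<close>
  define \<phi> where "\<phi> x = (Re (f (of_real x)))\<^sup>2 + (Im (f (of_real x)))\<^sup>2" for x
  have d\<phi>: "\<exists>y. (\<phi> has_real_derivative y) (at x) \<and> y \<le> 0" if "x > 1" for x
  proof -
    define d where "d = - W (of_real x) * f (of_real x)"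
    have "((\<lambda>x. f (of_real x)) has_vector_derivative d) (at x)"
      unfolding d_def using df[of "of_real x"] that by (intro has_vector_derivative_real_field) auto
    then have R: "((\<lambda>x. Re (f (of_real x))) has_real_derivative Re d) (at x)"
      and I: "((\<lambda>x. Im (f (of_real x))) has_real_derivative Im d) (at x)"
      unfolding has_real_derivative_iff_has_vector_derivative
      by (auto intro: bounded_linear.has_vector_derivative[OF bounded_linear_Re]
                      bounded_linear.has_vector_derivative[OF bounded_linear_Im])
    have "(\<phi> has_real_derivative 2 * Re (f (of_real x)) * Re d + 2 * Im (f (of_real x)) * Im d) (at x)"
      using DERIV_add[OF DERIV_power[OF R, of 2] DERIV_power[OF I, of 2]]
      by (simp add: \<phi>_def [abs_def] mult_ac)
    moreover have "2 * Re (f (of_real x)) * Re d + 2 * Im (f (of_real x)) * Im d = - (2 * Re (W (of_real x)) * \<phi> x)"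
      unfolding \<phi>_def d_def by (simp add: power2_eq_square) (simp add: algebra_simps)
    moreover have "Re (W (of_real x)) \<ge> 0"
      unfolding W_def c using that by (rule three_four_one_nonneg)
    moreover have "\<phi> x \<ge> 0" by (simp add: \<phi>_def)
    ultimately show ?thesis by (metis (no_types) mult_nonneg_nonneg neg_le_0_iff_le zero_le_numeral)
  qed
  have \<phi>_norm: "\<phi> x = (norm (f (of_real x)))\<^sup>2" for x by (simp add: \<phi>_def cmod_power2)
  have "\<phi> 2 \<le> \<phi> \<sigma>"
  proof (rule DERIV_nonpos_imp_nonincreasing[where f = \<phi>])
    show "\<exists>y. (\<phi> has_real_derivative y) (at x) \<and> y \<le> 0" if "\<sigma> \<le> x" for x
      using \<sigma> that by (intro d\<phi>) simp
  qed (use \<sigma> in simp)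
  then have "norm (f 2) \<le> norm (f (of_real \<sigma>))"
    unfolding \<phi>_norm by (simp only: of_real_numeral) (rule power2_le_imp_le, simp_all)
  \<comment> \<open>Each of the eight factors, counted with multiplicity, is at least 1/3 on Re s =
    2.\<close>
  moreover have "(1 / 3) ^ 3 * (1 / 3) ^ 4 * (1 / 3) \<le> norm (f 2)"
    unfolding f_def norm_mult norm_power Z_def
    by (intro mult_mono power_mono norm_zeta_line_2 mult_nonneg_nonneg) (auto simp: c_def)
  moreover have "(1 / 3) ^ 3 * (1 / 3) ^ 4 * (1 / 3) = (1 / 3 ^ 8 :: real)"
    by (simp add: field_simps)
  ultimately have "1 / 3 ^ 8 \<le> norm (f (of_real \<sigma>))" by linarith
  then show ?thesis
    unfolding f_def norm_mult norm_power Z_def c .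
qed

text \<open>Fixes one exponent and one constant for zeta and its first two derivatives on the strip
  1 < Re s \<le> 2, where \<open>real k + norm s \<le> 4 + \<bar>Im s\<bar>\<close>.\<close>

locale zeta_growth =
  fixes \<theta> M :: real
  assumes \<theta>: "0 < \<theta>" "\<theta> \<le> 1" and M: "M \<ge> 1"
  assumes zeta_log_approx: "\<And>k s. k \<le> 2 \<Longrightarrow> 1 < Re s \<Longrightarrow> Re s \<le> 2 \<Longrightarrow>
    norm (zeta_log k s - fact k / (s - 1) ^ Suc k) \<le> M * (4 + \<bar>Im s\<bar>) powr \<theta>"

lemma zeta_growth_exists:
  assumes "0 < \<theta>" "\<theta> \<le> 1"
  obtains M where "zeta_growth \<theta> M"
proof -
  have "\<exists>C>0. \<forall>s. Re s > 1 \<longrightarrow> norm (zeta_log k s - fact k / (s - 1) ^ Suc k) \<le> C * (real k + norm s) powr \<theta>" for k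
    using zeta_log_bound[OF assms, of k] by metis
  then obtain C where C: "\<And>k. C k > 0"
    "\<And>k s. Re s > 1 \<Longrightarrow> norm (zeta_log k s - fact k / (s - 1) ^ Suc k) \<le> C k * (real k + norm s) powr \<theta>"
    by metis
  define M where "M = 1 + C 0 + C 1 + C 2"
  have CM: "C k \<le> M" if "k \<le> 2" for k
  proof -
    from that have "k = 0 \<or> k = 1 \<or> k = 2" by auto
    then show ?thesis using C(1)[of 0] C(1)[of 1] C(1)[of 2] by (auto simp: M_def)
  qed
  have "zeta_growth \<theta> M"
  proof
    show "M \<ge> 1" using C(1)[of 0] C(1)[of 1] C(1)[of 2] by (simp add: M_def)
    fix k :: nat and s :: complex assume k: "k \<le> 2" and s: "1 < Re s" "Re s \<le> 2"
    have "norm (zeta_log k s - fact k / (s - 1) ^ Suc k) \<le> C k * (real k + norm s) powr \<theta>"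
      by (rule C(2)[OF s(1)])
    also have "real k + norm s \<le> 4 + \<bar>Im s\<bar>"
      using cmod_le[of s] k s by linarith
    then have "C k * (real k + norm s) powr \<theta> \<le> M * (4 + \<bar>Im s\<bar>) powr \<theta>"
      using CM[OF k] C(1)[of k] assms by (intro mult_mono powr_mono2) auto
    finally show "norm (zeta_log k s - fact k / (s - 1) ^ Suc k) \<le> M * (4 + \<bar>Im s\<bar>) powr \<theta>" .
  qed (use assms in auto)
  then show ?thesis by (rule that)
qed

section \<open>Lower bounds for zeta from the growth bound and the product inequality\<close>

context zeta_growth
begin

definition B :: "real \<Rightarrow> real" where "B t = (4 + \<bar>t\<bar>) powr \<theta>"

lemma B_ge_1: "B t \<ge> 1"
  using \<theta> by (simp add: B_def ge_one_powr_ge_zero)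

lemma B_le: "B t \<le> 4 + \<bar>t\<bar>"
  using \<theta> powr_mono[of \<theta> 1 "4 + \<bar>t\<bar>"] by (simp add: B_def)

lemma B_double: "B (2 * t) \<le> 2 * B t"
proof -
  have "B (2 * t) \<le> (2 * (4 + \<bar>t\<bar>)) powr \<theta>"
    unfolding B_def using \<theta> by (intro powr_mono2) auto
  also have "\<dots> = 2 powr \<theta> * B t" by (simp only: B_def powr_mult)
  also have "\<dots> \<le> 2 * B t"
    using powr_mono[of \<theta> 1 2] \<theta> B_ge_1[of t] by (intro mult_right_mono) auto
  finally show ?thesis .
qed

lemma zeta_log_approx':
  assumes "k \<le> 2" "1 < Re s" "Re s \<le> 2"
  shows "norm (zeta_log k s - fact k / (s - 1) ^ Suc k) \<le> M * B (Im s)"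
  using zeta_log_approx[OF assms] by (simp add: B_def)

lemma norm_zeta_log_le:
  assumes "k \<le> 2" "1 < Re s" "Re s \<le> 2"
  shows "norm (zeta_log k s) \<le> fact k / norm (s - 1) ^ Suc k + M * B (Im s)"
  using norm_triangle_sub[of "zeta_log k s" "fact k / (s - 1) ^ Suc k"] zeta_log_approx'[OF assms]
  by (simp add: norm_divide norm_power norm_mult)

text \<open>Radius of a disc about the pole: for \<open>s\<close> in the strip with
  \<open>norm (s - 1) < \<kappa>\<close>, the bound \<open>B (Im s) \<le> 5\<close> gives
  \<open>norm ((s - 1) * zeta_log 0 s - 1) \<le> 1 / 2\<close>.\<close>

definition \<kappa> :: real where "\<kappa> = 1 / (10 * M)"
text \<open>Collects \<open>3 ^ 8\<close> from \<open>zeta_three_four_one\<close>,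
  \<open>5 * M\<close> from the bound at the real point and \<open>12 * M\<close> from the bound at
  the doubled height.\<close>

definition c\<^sub>1 :: real where "c\<^sub>1 = 1 / (3 ^ 8 * (5 * M) ^ 3 * (12 * M))"

lemma \<kappa>: "\<kappa> > 0" "1 / \<kappa> = 10 * M" "\<kappa> \<le> 1 / 10"
  using M by (auto simp: \<kappa>_def field_simps)

text \<open>Solves \<open>zeta_three_four_one\<close> for the fourth power, with the other two
  factors bounded above. The distance condition keeps the point of doubled height away from the pole
  as well.\<close>

lemma norm_zeta_power4_lower:
  assumes s: "1 < Re s" "Re s \<le> 2" and far: "norm (s - 1) \<ge> \<kappa>"
  shows "norm (zeta_log 0 s) ^ 4 \<ge> c\<^sub>1 * (Re s - 1) ^ 3 / B (Im s)"
proof -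
  define \<rho> where "\<rho> = Re s - 1"
  define X where "X = norm (zeta_log 0 s)"
  define b where "b = B (Im s)"
  have \<rho>: "0 < \<rho>" "\<rho> \<le> 1" using s by (auto simp: \<rho>_def)
  have b: "b \<ge> 1" unfolding b_def by (rule B_ge_1)
  have "norm (zeta_log 0 (of_real (Re s))) \<le> 1 / norm (of_real (Re s) - 1 :: complex) + M * B 0"
    using norm_zeta_log_le[of 0 "of_real (Re s)"] s by simp
  also have "norm (of_real (Re s) - 1 :: complex) = \<rho>"
    using \<rho> by (simp add: \<rho>_def cmod_def)
  also have "M * B 0 \<le> 4 * M / \<rho>"
  proof -
    have "M * B 0 \<le> M * 4" using M B_le[of 0] by (intro mult_left_mono) auto
    also have "\<dots> \<le> 4 * M / \<rho>" using M \<rho> by (simp add: field_simps)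
    finally show ?thesis .
  qed
  also have "1 / \<rho> + 4 * M / \<rho> \<le> 5 * M / \<rho>" using M \<rho> by (simp add: field_simps)
  finally have 1: "norm (zeta_log 0 (of_real (Re s))) \<le> 5 * M / \<rho>" by simp
  define s' where "s' = Complex (Re s) (2 * Im s)"
  have "norm (s - 1) \<le> norm (s' - 1)"
    by (auto simp: cmod_def s'_def power_mult_distrib)
  then have "1 / norm (s' - 1) \<le> 1 / \<kappa>"
    using far \<kappa> by (intro divide_left_mono) (auto intro!: mult_pos_pos)
  then have "norm (zeta_log 0 s') \<le> 10 * M + M * B (2 * Im s)"
    using norm_zeta_log_le[of 0 s'] s \<kappa> by (simp add: s'_def)
  also have "M * B (2 * Im s) \<le> M * (2 * b)"
    unfolding b_def using M B_double by (intro mult_left_mono) auto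
  also have "10 * M + M * (2 * b) \<le> 12 * M * b"
    using M b mult_left_mono[of 1 b "10 * M"] by (simp add: algebra_simps)
  finally have 2: "norm (zeta_log 0 s') \<le> 12 * M * b" by simp
  have "1 / 3 ^ 8 \<le> norm (zeta_log 0 (of_real (Re s))) ^ 3 * X ^ 4 * norm (zeta_log 0 s')"
    using zeta_three_four_one[OF s, of "Im s"] by (simp add: X_def s'_def)
  also have "\<dots> \<le> (5 * M / \<rho>) ^ 3 * X ^ 4 * (12 * M * b)"
    using 1 2 M \<rho> b by (intro mult_mono power_mono) (auto simp: X_def)
  finally have "1 / 3 ^ 8 \<le> (5 * M / \<rho>) ^ 3 * X ^ 4 * (12 * M * b)" .
  also have "(5 * M / \<rho>) ^ 3 * X ^ 4 * (12 * M * b) = (1 / 3 ^ 8) * X ^ 4 / (c\<^sub>1 * \<rho> ^ 3 / b)"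
    using M \<rho> b by (simp add: c\<^sub>1_def field_simps)
  finally have "c\<^sub>1 * \<rho> ^ 3 / b \<le> X ^ 4"
  proof -
    assume *: "1 / 3 ^ 8 \<le> (1 / 3 ^ 8) * X ^ 4 / (c\<^sub>1 * \<rho> ^ 3 / b)"
    have "c\<^sub>1 * \<rho> ^ 3 / b > 0" using M \<rho> b by (simp add: c\<^sub>1_def)
    from pos_le_divide_eq[OF this, THEN iffD1, OF *] show ?thesis by simp
  qed
  then show ?thesis by (simp only: X_def b_def \<rho>_def)
qed

text \<open>Within \<open>e ^ 4 / B (Im s) ^ 5\<close> of the line \<open>Re s = 1\<close> the product inequality is too weak and is
  replaced by the mean value theorem; \<open>e\<close> is so small that this costs at most half of the lower bound.\<close>

definition d :: real where "d = root 4 c\<^sub>1"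
definition e :: real where "e = d / (202 * M\<^sup>2)"

lemma d: "d > 0" "d ^ 4 = c\<^sub>1" "d \<le> 1" "c\<^sub>1 > 0"
proof -
  show c: "c\<^sub>1 > 0" using M by (simp add: c\<^sub>1_def)
  then show "d > 0" "d ^ 4 = c\<^sub>1" by (auto simp: d_def)
  have "3 ^ 8 * (5 * M) ^ 3 * (12 * M) \<ge> 1 * 1 * 1"
    using M by (intro mult_mono one_le_power) auto
  then have "c\<^sub>1 \<le> 1" by (simp add: c\<^sub>1_def)
  then show "d \<le> 1" by (simp add: d_def)
qed

lemma e: "e > 0" "e \<le> 1" "202 * M\<^sup>2 * e = d"
proof -
  have M2: "M\<^sup>2 \<ge> 1" using M by simp
  then show "e > 0" "202 * M\<^sup>2 * e = d" using d M by (auto simp: e_def)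
  have "d \<le> 202 * M\<^sup>2" using d M2 by linarith
  then show "e \<le> 1" using M by (simp add: e_def)
qed

lemma norm_zeta_lower_aux:
  assumes s: "Re s \<le> 2" and far: "norm (s - 1) \<ge> \<kappa>" and big: "Re s - 1 \<ge> e ^ 4 / B (Im s) ^ 5"
  shows "norm (zeta_log 0 s) \<ge> d * e ^ 3 / B (Im s) ^ 4"
proof (rule power_le_imp_le_base)
  define b where "b = B (Im s)"
  have b: "b \<ge> 1" unfolding b_def by (rule B_ge_1)
  have pos: "e ^ 4 / b ^ 5 > 0" using e b by simp
  \<comment> \<open>Exact since 5 * 3 + 1 = 4 * 4: the threshold \<open>e ^ 4 / b ^ 5\<close> is
    chosen so that taking the fourth root leaves no fractional powers.\<close>
  have "(d * e ^ 3 / b ^ 4) ^ Suc 3 = c\<^sub>1 * (e ^ 4 / b ^ 5) ^ 3 / b"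
    using b unfolding d(2)[symmetric] by (simp add: field_simps power_numeral_reduce)
  also have "\<dots> \<le> c\<^sub>1 * (Re s - 1) ^ 3 / b"
    using big b pos d by (intro divide_right_mono mult_left_mono power_mono) (auto simp: b_def)
  also have "\<dots> \<le> norm (zeta_log 0 s) ^ Suc 3"
    using norm_zeta_power4_lower[OF _ s far] big pos by (simp add: b_def)
  finally show "(d * e ^ 3 / B (Im s) ^ 4) ^ Suc 3 \<le> norm (zeta_log 0 s) ^ Suc 3"
    by (simp add: b_def)
qed auto

lemma norm_zeta_lower:
  assumes s: "1 < Re s" "Re s \<le> 2" and far: "norm (s - 1) \<ge> \<kappa>"
  shows "norm (zeta_log 0 s) \<ge> d * e ^ 3 / 2 / B (Im s) ^ 4"
proof -
  define b where "b = B (Im s)"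
  have b: "b \<ge> 1" unfolding b_def by (rule B_ge_1)
  define \<rho> where "\<rho> = e ^ 4 / b ^ 5"
  have "e ^ 4 \<le> 1" using e by (intro power_le_one) auto
  also have "1 \<le> b ^ 5" using b by simp
  finally have \<rho>: "0 < \<rho>" "\<rho> \<le> 1" using e b by (auto simp: \<rho>_def)
  have pos: "d * e ^ 3 / b ^ 4 > 0" using d e b by simp
  show ?thesis
  proof (cases "Re s - 1 \<ge> \<rho>")
    case True
    then have "norm (zeta_log 0 s) \<ge> d * e ^ 3 / b ^ 4"
      using s far unfolding b_def by (intro norm_zeta_lower_aux) (auto simp: \<rho>_def b_def)
    with pos show ?thesis by (simp add: b_def)
  next
    case False
    \<comment> \<open>Too close to the line: compare with the point of the same height on Re s = 1 +
      \<rho>, where \<open>norm_zeta_lower_aux\<close> applies.\<close>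
    define s\<^sub>1 where "s\<^sub>1 = Complex (1 + \<rho>) (Im s)"
    define S where "S = closed_segment s s\<^sub>1"
    have S: "Im z = Im s \<and> Re s \<le> Re z \<and> Re z \<le> 1 + \<rho>" if "z \<in> S" for z
    proof -
      have "Re z \<in> closed_segment (Re s) (1 + \<rho>)" "Im z \<in> closed_segment (Im s) (Im s)"
        using that closed_segment_linear_image[of Re s s\<^sub>1] closed_segment_linear_image[of Im s s\<^sub>1]
          bounded_linear.linear[OF bounded_linear_Re] bounded_linear.linear[OF bounded_linear_Im]
        by (auto simp: S_def s\<^sub>1_def)
      then show ?thesis using False by (auto simp: closed_segment_eq_real_ivl)
    qed
    have S_far: "norm (z - 1) \<ge> \<kappa>" if "z \<in> S" for z
    proof -
      have "\<bar>Re (s - 1)\<bar> \<le> \<bar>Re (z - 1)\<bar>" "Im (z - 1) = Im (s - 1)" using S[OF that] s by auto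
      then have "norm (s - 1) \<le> norm (z - 1)"
        unfolding cmod_def by (intro real_sqrt_le_mono add_mono) (auto simp: abs_le_square_iff)
      with far show ?thesis by linarith
    qed
    have s1: "s\<^sub>1 \<in> S" by (simp add: S_def)
    have low: "norm (zeta_log 0 s\<^sub>1) \<ge> d * e ^ 3 / b ^ 4"
      using norm_zeta_lower_aux[of s\<^sub>1] S_far[OF s1] \<rho> by (simp add: s\<^sub>1_def b_def \<rho>_def)
    \<comment> \<open>The pole contributes \<open>1 / \<kappa> ^ 2\<close>, hence 100, and the error
      term contributes 1. Moving right does not approach the pole, so \<open>S_far\<close> covers
      the segment.\<close>
    have deriv: "norm (- zeta_log 1 z) \<le> 101 * M\<^sup>2 * b" if "z \<in> S" for z
    proof -
      have "norm (zeta_log 1 z) \<le> 1 / norm (z - 1) ^ 2 + M * b"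
        using norm_zeta_log_le[of 1 z] S[OF that] s \<rho> by (simp add: b_def power2_eq_square)
      also have "1 / norm (z - 1) ^ 2 \<le> 1 / \<kappa> ^ 2"
        using S_far[OF that] \<kappa> by (intro divide_left_mono power_mono) (auto intro!: mult_pos_pos)
      also have "\<dots> = 100 * M\<^sup>2" by (simp add: \<kappa>_def power2_eq_square)
      also have "100 * M\<^sup>2 \<le> 100 * M\<^sup>2 * b" using b M mult_left_mono[of 1 b "100 * M\<^sup>2"] by simp
      also have "M * b \<le> M\<^sup>2 * b" using M b by (simp add: power2_eq_square)
      finally show ?thesis by (simp add: algebra_simps)
    qed
    have "norm (zeta_log 0 s\<^sub>1 - zeta_log 0 s) \<le> 101 * M\<^sup>2 * b * norm (s\<^sub>1 - s)"
    proof (rule field_differentiable_bound[of S _ "\<lambda>z. - zeta_log 1 z"])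
      fix z assume "z \<in> S"
      then show "(zeta_log 0 has_field_derivative - zeta_log 1 z) (at z within S)"
        using has_field_derivative_zeta_log[of z 0] S[of z] s by (auto intro!: has_field_derivative_at_within)
      from \<open>z \<in> S\<close> show "norm (- zeta_log 1 z) \<le> 101 * M\<^sup>2 * b" by (rule deriv)
    qed (simp_all add: S_def)
    also have "norm (s\<^sub>1 - s) \<le> \<rho>"
      using False s by (simp add: s\<^sub>1_def cmod_def)
    then have "101 * M\<^sup>2 * b * norm (s\<^sub>1 - s) \<le> 101 * M\<^sup>2 * b * \<rho>"
      using b by (intro mult_left_mono) auto
    \<comment> \<open>Here the choices of \<open>\<rho>\<close> and \<open>e\<close> pay off: the
      change along the segment is at most half of the bound in \<open>low\<close>.\<close>
    also have "\<dots> = (202 * M\<^sup>2 * e) * e ^ 3 / 2 / b ^ 4"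
      using b by (simp add: \<rho>_def divide_simps) (simp add: power_numeral_reduce)
    also have "\<dots> = d * e ^ 3 / 2 / b ^ 4" by (simp only: e)
    finally have "norm (zeta_log 0 s\<^sub>1 - zeta_log 0 s) \<le> d * e ^ 3 / 2 / b ^ 4" .
    then show ?thesis
      using low norm_triangle_ineq2[of "zeta_log 0 s\<^sub>1" "zeta_log 0 s"]
      unfolding b_def [symmetric] by linarith
  qed
qed

text \<open>The factor \<open>s - 1\<close> removes the pole and contributes linear growth in the
  height, which later cancels the same growth in the numerator of
  \<open>dser_mangoldt_ln_bound\<close>.\<close>

lemma norm_zeta_mult_lower:
  obtains c where "c > 0" "\<And>s. 1 < Re s \<Longrightarrow> Re s \<le> 2 \<Longrightarrow>
    norm ((s - 1) * zeta_log 0 s) \<ge> c * (4 + \<bar>Im s\<bar>) / B (Im s) ^ 4"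
proof
  \<comment> \<open>The first entry serves the disc about the pole, where \<open>A \<le> 5\<close>
    and the product has modulus at least 1/2; the second serves its complement, where
    \<open>norm (s - 1) \<ge> \<kappa> * A / 5\<close>.\<close>
  define c where "c = min (1 / 10) (\<kappa> / 5 * (d * e ^ 3 / 2))"
  show c: "c > 0" using \<kappa> d e by (simp add: c_def)
  fix s :: complex assume s: "1 < Re s" "Re s \<le> 2"
  define A where "A = 4 + \<bar>Im s\<bar>"
  define b where "b = B (Im s)"
  have b: "b \<ge> 1" unfolding b_def by (rule B_ge_1)
  have Im_le: "\<bar>Im s\<bar> \<le> norm (s - 1)" using abs_Im_le_cmod[of "s - 1"] by simp
  show "norm ((s - 1) * zeta_log 0 s) \<ge> c * (4 + \<bar>Im s\<bar>) / B (Im s) ^ 4"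
  proof (cases "norm (s - 1) \<ge> \<kappa>")
    case True
    have "\<kappa> * A / 5 \<le> norm (s - 1)"
    proof (cases "\<bar>Im s\<bar> \<ge> 1")
      case True
      have "\<kappa> * A \<le> 1 * A" using \<kappa> by (intro mult_right_mono) (auto simp: A_def)
      moreover have "A \<le> 5 * norm (s - 1)" using True Im_le by (simp add: A_def)
      ultimately show ?thesis by simp
    next
      case False
      then have "\<kappa> * A \<le> \<kappa> * 5" using \<kappa> by (intro mult_left_mono) (auto simp: A_def)
      then show ?thesis using True by simp
    qed
    then have "(\<kappa> * A / 5) * (d * e ^ 3 / 2 / b ^ 4) \<le> norm (s - 1) * norm (zeta_log 0 s)"
      using norm_zeta_lower[OF s True] d e b by (intro mult_mono) (auto simp: b_def)
    moreover have "c * A / b ^ 4 \<le> (\<kappa> / 5 * (d * e ^ 3 / 2)) * A / b ^ 4"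
      using b by (intro divide_right_mono mult_right_mono) (auto simp: c_def A_def)
    ultimately show ?thesis by (simp add: norm_mult A_def b_def mult_ac)
  next
    case False
    have "s \<noteq> 1" using s by auto
    then have "(s - 1) * zeta_log 0 s - 1 = (s - 1) * (zeta_log 0 s - fact 0 / (s - 1) ^ Suc 0)"
      by (simp add: field_simps)
    also have "norm \<dots> \<le> \<kappa> * (M * b)"
      unfolding norm_mult b_def using False s \<kappa> by (intro mult_mono zeta_log_approx') auto
    also have "\<dots> \<le> \<kappa> * (M * 5)"
      using B_le[of "Im s"] False Im_le \<kappa> M by (intro mult_left_mono) (auto simp: b_def)
    also have "\<dots> = 1 / 2" using M by (simp add: \<kappa>_def)
    finally have "norm ((s - 1) * zeta_log 0 s) \<ge> 1 / 2"
      using norm_triangle_ineq2[of 1 "1 - (s - 1) * zeta_log 0 s"] norm_minus_commute[of 1 "(s - 1) * zeta_log 0 s"] by simp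
    moreover have "c * A / b ^ 4 \<le> c * A"
      using b c divide_left_mono[of 1 "b ^ 4" "c * A"] by (simp add: A_def)
    moreover have "c * A \<le> 1 / 10 * 5"
      using False Im_le \<kappa> c by (intro mult_mono) (auto simp: c_def A_def)
    ultimately show ?thesis by (simp add: A_def b_def)
  qed
qed

end

section \<open>The logarithmic derivative\<close>

text \<open>With \<open>w = s - 1\<close> and \<open>K\<^sub>j\<close> the error terms of \<open>zeta_log_approx\<close>, multiplying the difference below
  by \<open>(w \<zeta>(s))\<^sup>2\<close> makes all poles at \<open>s = 1\<close> cancel.\<close>

lemma pole_cancellation:
  fixes w :: complex
  assumes w: "w \<noteq> 0"
    and Z: "Z\<^sub>0 = 1 / w + K\<^sub>0" "Z\<^sub>1 = 1 / w\<^sup>2 + K\<^sub>1" "Z\<^sub>2 = 2 / w ^ 3 + K\<^sub>2"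
    and L: "L * Z\<^sub>0 = Z\<^sub>1" "L\<^sub>1 * Z\<^sub>0 + L * Z\<^sub>1 = Z\<^sub>2"
  shows "(L\<^sub>1 - Z\<^sub>1) * (w * Z\<^sub>0)\<^sup>2 =
           w * K\<^sub>2 + w\<^sup>2 * K\<^sub>0 * K\<^sub>2 - 2 * K\<^sub>1 - w\<^sup>2 * K\<^sub>1\<^sup>2 - K\<^sub>0\<^sup>2 - K\<^sub>1 * (w * Z\<^sub>0)\<^sup>2"
proof -
  have "L\<^sub>1 * Z\<^sub>0\<^sup>2 = Z\<^sub>2 * Z\<^sub>0 - Z\<^sub>1\<^sup>2"
    unfolding L(2) [symmetric] L(1) [symmetric] by (simp add: algebra_simps power2_eq_square)
  moreover have "(L\<^sub>1 - Z\<^sub>1) * (w * Z\<^sub>0)\<^sup>2 = w\<^sup>2 * (L\<^sub>1 * Z\<^sub>0\<^sup>2) - Z\<^sub>1 * (w * Z\<^sub>0)\<^sup>2"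
    by (simp add: algebra_simps power2_eq_square)
  ultimately have "(L\<^sub>1 - Z\<^sub>1) * (w * Z\<^sub>0)\<^sup>2 = w\<^sup>2 * (Z\<^sub>2 * Z\<^sub>0 - Z\<^sub>1\<^sup>2) - Z\<^sub>1 * (w * Z\<^sub>0)\<^sup>2"
    by simp
  also have "w\<^sup>2 * (Z\<^sub>2 * Z\<^sub>0 - Z\<^sub>1\<^sup>2) = 1 / w\<^sup>2 + 2 * K\<^sub>0 / w + w * K\<^sub>2 + w\<^sup>2 * K\<^sub>0 * K\<^sub>2 - 2 * K\<^sub>1 - w\<^sup>2 * K\<^sub>1\<^sup>2"
    unfolding Z using w by (simp add: field_simps power2_eq_square power3_eq_cube)
  also have "Z\<^sub>1 * (w * Z\<^sub>0)\<^sup>2 = 1 / w\<^sup>2 + 2 * K\<^sub>0 / w + K\<^sub>0\<^sup>2 + K\<^sub>1 * (w * Z\<^sub>0)\<^sup>2"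
    unfolding Z using w by (simp add: field_simps power2_eq_square)
  finally show ?thesis by simp
qed

context zeta_growth
begin

text \<open>The identity \<open>pole_cancellation\<close> is divided by H^2, where H = (s - 1)
  \<zeta>(s). With A = 4 + \<bar>Im s\<bar> and b = B (Im s), the numerator is of order at most A^2
  b^2 and H^2 of order at least A^2 / b^8, so A cancels and b^10 remains.\<close>

lemma dser_mangoldt_ln_bound:
  obtains C where "C > 0" "\<And>s. 1 < Re s \<Longrightarrow> Re s \<le> 2 \<Longrightarrow>
    norm (dser (\<lambda>n. \<Lambda> n * ln (real n)) s - zeta_log 1 s) \<le> C * B (Im s) ^ 10"
proof -
  obtain c where c: "c > 0" and H_lower: "\<And>s. 1 < Re s \<Longrightarrow> Re s \<le> 2 \<Longrightarrow>
    norm ((s - 1) * zeta_log 0 s) \<ge> c * (4 + \<bar>Im s\<bar>) / B (Im s) ^ 4"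
    using norm_zeta_mult_lower by blast
  define C where "C = 6 * M\<^sup>2 / c\<^sup>2 + M"
  show ?thesis
  proof
    show "C > 0" using M c by (simp add: C_def add_nonneg_pos)
    fix s :: complex assume s: "1 < Re s" "Re s \<le> 2"
    define w where "w = s - 1"
    define A where "A = 4 + \<bar>Im s\<bar>"
    define b where "b = B (Im s)"
    have b: "b \<ge> 1" unfolding b_def by (rule B_ge_1)
    have A: "A \<ge> 1" by (simp add: A_def)
    have w: "w \<noteq> 0" using s by (auto simp: w_def)
    have wA: "norm w \<le> A" using cmod_le[of w] s by (simp add: A_def w_def)
    define D where "D = dser (\<lambda>n. \<Lambda> n * ln (real n)) s - zeta_log 1 s"
    define H where "H = w * zeta_log 0 s"
    define K where "K k = zeta_log k s - fact k / w ^ Suc k" for k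
    have K: "norm (K k) \<le> M * b" if "k \<le> 2" for k
      unfolding K_def w_def b_def using that s by (rule zeta_log_approx')
    have "D * H\<^sup>2 = w * K 2 + w\<^sup>2 * K 0 * K 2 - 2 * K 1 - w\<^sup>2 * (K 1)\<^sup>2 - (K 0)\<^sup>2 - K 1 * H\<^sup>2"
      unfolding D_def H_def
    proof (rule pole_cancellation[OF w])
      show "dser \<Lambda> s * zeta_log 0 s = zeta_log 1 s" using s by (intro dser_mangoldt_mult_zeta)
      show "dser (\<lambda>n. \<Lambda> n * ln (real n)) s * zeta_log 0 s + dser \<Lambda> s * zeta_log 1 s = zeta_log 2 s"
        using s by (intro dser_mangoldt_ln_mult_zeta)
    qed (simp_all add: K_def power2_eq_square power3_eq_cube eval_nat_numeral)
    moreover define R where "R = w * K 2 + w\<^sup>2 * K 0 * K 2 - 2 * K 1 - w\<^sup>2 * (K 1)\<^sup>2 - (K 0)\<^sup>2"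
    ultimately have DH: "(D + K 1) * H\<^sup>2 = R" by (simp add: distrib_right)
    define Y where "Y = M\<^sup>2 * b\<^sup>2 * A\<^sup>2"
    have Mb: "M * b \<ge> 1" using mult_mono[of 1 M 1 b] M b by simp
    have MbY: "M * b \<le> (M * b)\<^sup>2" "(M * b)\<^sup>2 \<le> Y" "A * (M * b) \<le> Y" "A\<^sup>2 * (M * b) * (M * b) \<le> Y"
    proof -
      show 1: "M * b \<le> (M * b)\<^sup>2" using mult_left_mono[OF Mb, of "M * b"] Mb by (simp add: power2_eq_square)
      have A2: "A\<^sup>2 \<ge> 1" "A \<le> A\<^sup>2" using A mult_left_mono[of 1 A A] one_le_power[OF A, of 2] by (simp_all add: power2_eq_square)
      show "(M * b)\<^sup>2 \<le> Y" using mult_left_mono[OF A2(1), of "(M * b)\<^sup>2"] by (simp add: Y_def power_mult_distrib)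
      have "A * (M * b) \<le> A\<^sup>2 * (M * b)\<^sup>2" using 1 A2 A Mb by (intro mult_mono) auto
      then show "A * (M * b) \<le> Y" by (simp add: Y_def power_mult_distrib mult_ac)
    qed (simp add: Y_def power2_eq_square mult_ac)
    have "norm R \<le> norm (w * K 2) + norm (w\<^sup>2 * K 0 * K 2) + norm (2 * K 1) + norm (w\<^sup>2 * (K 1)\<^sup>2) + norm ((K 0)\<^sup>2)"
      unfolding R_def by (intro order_trans[OF norm_triangle_ineq4] order_trans[OF norm_triangle_ineq] add_mono order_refl)
    also have "\<dots> \<le> A * (M * b) + A\<^sup>2 * (M * b) * (M * b) + 2 * (M * b) + A\<^sup>2 * (M * b)\<^sup>2 + (M * b)\<^sup>2"
      unfolding norm_mult norm_power using K wA A Mb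
      by (intro add_mono mult_mono power_mono) auto
    also have "\<dots> \<le> 6 * Y" using MbY by (simp add: power2_eq_square mult_ac)
    finally have R: "norm R \<le> 6 * Y" .
    have "c * A / b ^ 4 \<le> norm H"
      using H_lower[OF s] by (simp add: H_def w_def A_def b_def)
    then have "(c * A / b ^ 4)\<^sup>2 \<le> (norm H)\<^sup>2"
      using c A b by (intro power_mono) auto
    then have "norm (D + K 1) * (c * A / b ^ 4)\<^sup>2 \<le> norm (D + K 1) * (norm H)\<^sup>2"
      by (intro mult_left_mono) auto
    also have "\<dots> = norm R" unfolding DH [symmetric] by (simp add: norm_mult norm_power)
    also note R
    finally have "norm (D + K 1) \<le> 6 * Y / (c * A / b ^ 4)\<^sup>2"
      using c A b by (subst pos_le_divide_eq) auto
    also have "\<dots> = 6 * M\<^sup>2 / c\<^sup>2 * b ^ 10"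
      using c A b by (simp add: Y_def field_simps power_numeral_reduce)
    finally have "norm (D + K 1) \<le> 6 * M\<^sup>2 / c\<^sup>2 * b ^ 10" .
    moreover have "norm (K 1) \<le> M * b ^ 10"
    proof -
      have "b \<le> b ^ 10" using b power_increasing[of 1 10 b] by simp
      then have "M * b \<le> M * b ^ 10" using M by (intro mult_left_mono) auto
      with K[of 1] show ?thesis by simp
    qed
    moreover have "norm D \<le> norm (D + K 1) + norm (K 1)"
      using norm_triangle_ineq4[of "D + K 1" "K 1"] by simp
    ultimately show "norm (dser (\<lambda>n. \<Lambda> n * ln (real n)) s - zeta_log 1 s) \<le> C * B (Im s) ^ 10"
      by (simp add: D_def C_def b_def ring_distribs)
  qed
qed

end

lemma mangoldt_ln_bound:
  assumes "0 < p" "p \<le> 1"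
  obtains C where "C > 0" "\<And>\<sigma> t. 1 < \<sigma> \<Longrightarrow> \<sigma> \<le> 2 \<Longrightarrow>
    norm (dser (\<lambda>n. (\<Lambda> n - 1) * ln (real n)) (Complex \<sigma> t)) \<le> C * (4 + \<bar>t\<bar>) powr p"
proof -
  \<comment> \<open>The tenth power in \<open>dser_mangoldt_ln_bound\<close> dictates the exponent
    \<open>p / 10\<close>.\<close>
  obtain M where "zeta_growth (p / 10) M"
    using zeta_growth_exists[of "p / 10"] assms by auto
  then interpret zeta_growth "p / 10" M .
  obtain C where C: "C > 0" "\<And>s. 1 < Re s \<Longrightarrow> Re s \<le> 2 \<Longrightarrow>
    norm (dser (\<lambda>n. \<Lambda> n * ln (real n)) s - zeta_log 1 s) \<le> C * B (Im s) ^ 10"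
    using dser_mangoldt_ln_bound by blast
  have "norm (dser (\<lambda>n. (\<Lambda> n - 1) * ln (real n)) (Complex \<sigma> t)) \<le> C * (4 + \<bar>t\<bar>) powr p"
    if \<sigma>: "1 < \<sigma>" "\<sigma> \<le> 2" for \<sigma> t
  proof -
    have "dser (\<lambda>n. (\<Lambda> n - 1) * ln (real n)) (Complex \<sigma> t) =
        dser (\<lambda>n. \<Lambda> n * ln (real n)) (Complex \<sigma> t) - zeta_log 1 (Complex \<sigma> t)"
      using dser_diff[OF abs_conv_mangoldt_ln abs_conv_ln_power[of 1], of "Complex \<sigma> t"] \<sigma>
      by (simp add: algebra_simps)
    also have "norm \<dots> \<le> C * B t ^ 10" using C(2)[of "Complex \<sigma> t"] \<sigma> by simp
    also have "B t ^ 10 = (4 + \<bar>t\<bar>) powr p"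
      by (simp add: B_def powr_power)
    finally show ?thesis .
  qed
  with C(1) show ?thesis by (rule that)
qed

section \<open>Gaussian smoothing\<close>

text \<open>A Gaussian weight on \<open>ln n\<close> is the average of \<open>n \<mapsto> n powr (- i t)\<close> against the normal
  distribution, so the weighted sum is an average of the Dirichlet series over a vertical line.\<close>

lemma gaussian_sum_bound:
  fixes a :: "nat \<Rightarrow> real"
  assumes a: "abs_conv a" and \<sigma>: "\<sigma> > 1" and \<eta>: "0 < \<eta>" "\<eta> \<le> 1" and p: "0 \<le> p" "p \<le> 1" and C: "C \<ge> 0"
    and bound: "\<And>t. norm (dser a (Complex \<sigma> t)) \<le> C * (4 + \<bar>t\<bar>) powr p"
  shows "\<bar>\<Sum>n. a n * real n powr (- \<sigma>) * exp (- ((ln (real n) - c) / \<eta>)\<^sup>2 / 2)\<bar> \<le> 6 * C * \<eta> powr (- p)"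
proof -
  let ?N = "std_normal_distribution"
  interpret real_distribution ?N by (rule real_dist_normal_dist)
  \<comment> \<open>Sampling the line at height \<open>x / \<eta>\<close> sets the width of the
    weight, and the phase moves its centre from 0 to \<open>c\<close>.\<close>
  define f where "f n x = of_real (a n) * of_nat n powr (- Complex \<sigma> (x / \<eta>)) * iexp (x * c / \<eta>)" for n x
  define A where "A n = a n * real n powr (- \<sigma>)" for n
  have f_eq: "f n x = of_real (A n) * iexp ((c - ln (real n)) / \<eta> * x)" for n x
  proof (cases "n = 0")
    case False
    have "of_nat n powr (- Complex \<sigma> (x / \<eta>)) = exp (of_real (- \<sigma> * ln (real n)) + \<i> * of_real (- (x / \<eta>) * ln (real n)))"
      using False by (simp add: powr_def Complex_eq algebra_simps)
    also have "\<dots> = of_real (real n powr (- \<sigma>)) * iexp (- (x / \<eta>) * ln (real n))"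
      unfolding exp_add using False by (simp add: powr_def flip: exp_of_real)
    finally have "f n x = of_real (A n) * (iexp (- (x / \<eta>) * ln (real n)) * iexp (x * c / \<eta>))"
      by (simp add: f_def A_def)
    also have "iexp (- (x / \<eta>) * ln (real n)) * iexp (x * c / \<eta>) = iexp ((c - ln (real n)) / \<eta> * x)"
      unfolding exp_add [symmetric] using \<eta> by (intro arg_cong[of _ _ exp]) (simp add: field_simps)
    finally show ?thesis .
  qed (simp add: f_def A_def)
  have f_norm: "norm (f n x) = \<bar>A n\<bar>" for n x by (simp add: f_eq norm_mult)
  have f_int: "integrable ?N (f n)" for n
    unfolding f_eq by (intro integrable_mult_right integrable_iexp) auto
  have A_sum: "summable (\<lambda>n. \<bar>A n\<bar>)" using a \<sigma> by (simp add: abs_conv_def A_def abs_mult)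
  have int_f: "integral\<^sup>L ?N (f n) = of_real (A n * exp (- ((ln (real n) - c) / \<eta>)\<^sup>2 / 2))" for n
  proof -
    have "integral\<^sup>L ?N (f n) = of_real (A n) * char ?N ((c - ln (real n)) / \<eta>)"
      unfolding f_eq char_def by simp
    also have "((c - ln (real n)) / \<eta>)\<^sup>2 = ((ln (real n) - c) / \<eta>)\<^sup>2"
      by (simp add: power_divide power2_commute)
    ultimately show ?thesis by (simp add: char_std_normal_distribution power_divide power2_commute)
  qed
  have AE: "AE x in ?N. summable (\<lambda>n. norm (f n x))" using A_sum by (simp add: f_norm)
  have sumint: "summable (\<lambda>n. \<integral>x. norm (f n x) \<partial>?N)" using A_sum prob_space by (simp add: f_norm)
  define F where "F x = (\<Sum>n. f n x)" for x
  have F_int: "integrable ?N F" unfolding F_def by (rule integrable_suminf[OF f_int AE sumint])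
  have "(\<lambda>n. integral\<^sup>L ?N (f n)) sums integral\<^sup>L ?N F"
    unfolding F_def by (rule sums_integral[OF f_int AE sumint])
  then have "(\<lambda>n. of_real (A n * exp (- ((ln (real n) - c) / \<eta>)\<^sup>2 / 2)) :: complex) sums integral\<^sup>L ?N F"
    by (simp only: int_f)
  then have "(\<lambda>n. A n * exp (- ((ln (real n) - c) / \<eta>)\<^sup>2 / 2)) sums Re (integral\<^sup>L ?N F)"
    by (auto dest: sums_Re)
  then have "\<bar>\<Sum>n. A n * exp (- ((ln (real n) - c) / \<eta>)\<^sup>2 / 2)\<bar> \<le> norm (integral\<^sup>L ?N F)"
    using abs_Re_le_cmod by (simp add: sums_iff)
  \<comment> \<open>The majorant \<open>5 + x\<^sup>2\<close> has mean 6 under the normal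
    distribution; it comes from \<open>\<bar>x\<bar> \<le> 1 + x\<^sup>2\<close>,
    \<open>\<eta> \<le> 1\<close> and \<open>p \<le> 1\<close>.\<close>
  also have "\<dots> \<le> (\<integral>x. C * \<eta> powr (- p) * (5 + x\<^sup>2) \<partial>?N)"
  proof (rule Bochner_Integration.integral_norm_bound_integral[OF F_int])
    show "integrable ?N (\<lambda>x. C * \<eta> powr (- p) * (5 + x\<^sup>2))"
      by (intro integrable_mult_right Bochner_Integration.integrable_add integrable_const
            integrable_std_normal_distribution_moment)
    fix x :: real
    have "F x = dser a (Complex \<sigma> (x / \<eta>)) * iexp (x * c / \<eta>)"
      using sums_mult2[OF sums_dser[OF a, of "Complex \<sigma> (x / \<eta>)"], of "iexp (x * c / \<eta>)"] \<sigma>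
      by (simp add: F_def f_def sums_iff)
    then have "norm (F x) = norm (dser a (Complex \<sigma> (x / \<eta>)))" by (simp add: norm_mult)
    also have "\<dots> \<le> C * (4 + \<bar>x / \<eta>\<bar>) powr p" by (rule bound)
    also have "(4 + \<bar>x / \<eta>\<bar>) powr p \<le> (\<eta> powr (- 1) * (5 + x\<^sup>2)) powr p"
    proof (rule powr_mono2)
      have "\<bar>x\<bar> \<le> 1 + x\<^sup>2"
      proof -
        have "0 \<le> (\<bar>x\<bar> - 1)\<^sup>2 + \<bar>x\<bar>" by simp
        then show ?thesis by (simp add: power2_diff)
      qed
      then have "4 * \<eta> + \<bar>x\<bar> \<le> 5 + x\<^sup>2" using \<eta> by simp
      then have "(4 * \<eta> + \<bar>x\<bar>) / \<eta> \<le> (5 + x\<^sup>2) / \<eta>" using \<eta> by (intro divide_right_mono) auto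
      moreover have "(4 * \<eta> + \<bar>x\<bar>) / \<eta> = 4 + \<bar>x / \<eta>\<bar>" using \<eta> by (simp add: add_divide_distrib)
      moreover have "\<eta> powr (- 1) * (5 + x\<^sup>2) = (5 + x\<^sup>2) / \<eta>"
        using \<eta> by (simp add: powr_minus divide_inverse mult.commute)
      ultimately show "4 + \<bar>x / \<eta>\<bar> \<le> \<eta> powr (- 1) * (5 + x\<^sup>2)" by linarith
    qed (use p in auto)
    also have "\<dots> = \<eta> powr (- p) * (5 + x\<^sup>2) powr p" by (simp only: powr_mult powr_powr) simp
    also have "(5 + x\<^sup>2) powr p \<le> (5 + x\<^sup>2) powr 1" using p by (intro powr_mono) (auto intro: add_increasing2)
    finally show "norm (F x) \<le> C * \<eta> powr (- p) * (5 + x\<^sup>2)"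
      using C by (simp add: mult_left_mono mult.assoc)
  qed
  also have "\<dots> = C * \<eta> powr (- p) * (\<integral>x. 5 + x\<^sup>2 \<partial>?N)" by simp
  also have "(\<integral>x. 5 + x\<^sup>2 \<partial>?N) = (\<integral>x. 5 \<partial>?N) + (\<integral>x. x\<^sup>2 \<partial>?N)"
    by (intro Bochner_Integration.integral_add integrable_std_normal_distribution_moment) auto
  also have "(\<integral>x. x\<^sup>2 \<partial>?N) = 1" using std_normal_distribution_even_moments(1)[of 1] by simp
  also have "(\<integral>x. 5 \<partial>?N) = (5 :: real)" using prob_space by simp
  finally show ?thesis by (simp add: A_def mult_ac)
qed

section \<open>Upper and lower estimates of the smoothed sums\<close>

lemma summable_gaussian_weighted:
  assumes "abs_conv a" "\<sigma> > 1"
  shows "summable (\<lambda>n. a n * real n powr (- \<sigma>) * exp (- ((ln (real n) - c) / \<eta>)\<^sup>2 / 2))"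
proof (rule summable_comparison_test'[of _ 0])
  show "summable (\<lambda>n. \<bar>a n\<bar> * real n powr (- \<sigma>))" using assms by (simp add: abs_conv_def)
  show "norm (a n * real n powr (- \<sigma>) * exp (- ((ln (real n) - c) / \<eta>)\<^sup>2 / 2)) \<le> \<bar>a n\<bar> * real n powr (- \<sigma>)" for n
    by (simp add: abs_mult mult_left_le)
qed

text \<open>A proper prime power \<open>q ^ k\<close> has \<open>k \<ge> 2\<close>, hence
  \<open>q \<le> sqrt y\<close>, and \<open>2 ^ k \<le> y\<close> bounds \<open>k\<close> by
  \<open>2 * ln y\<close> since ln 2 \<ge> 1/2. Pairs \<open>(q, k)\<close> are counted, zero values
  included.\<close>

lemma card_proper_prime_powers:
  fixes y :: real
  assumes y: "y \<ge> 1"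
  shows "finite {n. primepow n \<and> \<not> prime n \<and> real n \<le> y}" (is "finite ?J")
    and "real (card {n. primepow n \<and> \<not> prime n \<and> real n \<le> y}) \<le> (sqrt y + 1) * (2 * ln y + 1)"
proof -
  define T where "T = {..nat \<lfloor>sqrt y\<rfloor>} \<times> {..nat \<lfloor>2 * ln y\<rfloor>}"
  have sub: "?J \<subseteq> (\<lambda>(q, k). q ^ k) ` T"
  proof safe
    fix n :: nat assume n: "primepow n" "\<not> prime n" "real n \<le> y"
    then obtain q k where qk: "prime q" "k > 0" "n = q ^ k" by (auto simp: primepow_def)
    have "k \<noteq> 1" using n qk by auto
    with qk have k: "k \<ge> 2" by simp
    have q: "q \<ge> 2" using qk prime_ge_2_nat by blast
    have "real q ^ 2 \<le> real q ^ k" using q k by (intro power_increasing) auto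
    also have "\<dots> \<le> y" using n qk by simp
    finally have "real q \<le> sqrt y" by (rule real_le_rsqrt)
    then have "q \<le> nat \<lfloor>sqrt y\<rfloor>" by linarith
    moreover have "k \<le> nat \<lfloor>2 * ln y\<rfloor>"
    proof -
      have "(2::real) ^ k \<le> real q ^ k" using q by (intro power_mono) auto
      also have "\<dots> \<le> y" using n qk by simp
      finally have "ln (2 ^ k) \<le> ln y" using y by (subst ln_le_cancel_iff) auto
      then have "real k * ln 2 \<le> ln y" by (simp add: ln_realpow)
      moreover have "real k * (1 / 2) \<le> real k * ln 2" using ln2_ge_two_thirds by (intro mult_left_mono) auto
      ultimately show ?thesis by linarith
    qed
    ultimately show "n \<in> (\<lambda>(q, k). q ^ k) ` T"
      using qk by (auto simp: T_def intro!: image_eqI[of _ _ "(q, k)"])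
  qed
  have T: "finite T" by (simp add: T_def)
  show "finite ?J" using finite_subset[OF sub] T by blast
  have "card ?J \<le> card T"
    using card_mono[OF finite_imageI[OF T] sub] card_image_le[OF T] by (rule order_trans)
  then have "real (card ?J) \<le> real (card T)" by simp
  also have "\<dots> = (real (nat \<lfloor>sqrt y\<rfloor>) + 1) * (real (nat \<lfloor>2 * ln y\<rfloor>) + 1)"
    by (simp add: T_def card_cartesian_product algebra_simps)
  also have "\<dots> \<le> (sqrt y + 1) * (2 * ln y + 1)"
    using y by (intro mult_mono add_mono) auto
  finally show "real (card ?J) \<le> (sqrt y + 1) * (2 * ln y + 1)" .
qed

lemma gaussian_mangoldt_upper:
  assumes l: "l \<ge> 3" and \<delta>: "0 < \<delta>" "\<delta> \<le> 1 / 2" and \<eta>: "\<eta> > 0" and \<sigma>: "\<sigma> > 1"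
    and no_prime: "\<And>p::nat. prime p \<Longrightarrow> \<not> (exp l \<le> real p \<and> real p \<le> exp l * (1 + \<delta>))"
  shows "(\<Sum>n. \<Lambda> n * ln (real n) * real n powr (- \<sigma>) * exp (- ((ln (real n) - (l + \<delta> / 4)) / \<eta>)\<^sup>2 / 2))
    \<le> exp (- (\<delta> / \<eta>)\<^sup>2 / 32) * (\<Sum>n. ln (real n) ^ 2 * real n powr (- \<sigma>))
        + (2 * exp (l / 2) + 1) * (4 * l + 1) * (4 * l\<^sup>2 / exp l)"
proof -
  define w where "w n = exp (- ((ln (real n) - (l + \<delta> / 4)) / \<eta>)\<^sup>2 / 2)" for n
  define J where "J = {n. primepow n \<and> \<not> prime n \<and> real n \<le> 2 * exp l}"
  define E where "E = exp (- (\<delta> / \<eta>)\<^sup>2 / 32)"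
  have el: "exp l \<ge> 4" using exp_ge_add_one_self[of l] l by linarith
  have J: "finite J" "real (card J) \<le> (sqrt (2 * exp l) + 1) * (2 * ln (2 * exp l) + 1)"
    unfolding J_def using el by (intro card_proper_prime_powers; simp)+
  have "(\<Sum>n. \<Lambda> n * ln (real n) * real n powr (- \<sigma>) * w n)
     \<le> (\<Sum>n. E * (ln (real n) ^ 2 * real n powr (- \<sigma>)) + (if n \<in> J then 4 * l\<^sup>2 / exp l else 0))"
  proof (rule suminf_le)
    show "summable (\<lambda>n. \<Lambda> n * ln (real n) * real n powr (- \<sigma>) * w n)"
      unfolding w_def by (intro summable_gaussian_weighted abs_conv_mangoldt_ln \<sigma>)
    show "summable (\<lambda>n. E * (ln (real n) ^ 2 * real n powr (- \<sigma>)) + (if n \<in> J then 4 * l\<^sup>2 / exp l else 0))"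
      by (intro summable_add summable_mult summable_ln_power_powr \<sigma> summable_If_finite_set J)
    fix n :: nat
    have le: "\<Lambda> n * ln (real n) * real n powr (- \<sigma>) * v \<le> ln (real n) ^ 2 * real n powr (- \<sigma>) * v"
      if "v \<ge> 0" for v
      using that mangoldt_le_ln[of n] unfolding power2_eq_square
      by (intro mult_right_mono) (auto simp: ln_nat_nonneg)
    show "\<Lambda> n * ln (real n) * real n powr (- \<sigma>) * w n \<le>
        E * (ln (real n) ^ 2 * real n powr (- \<sigma>)) + (if n \<in> J then 4 * l\<^sup>2 / exp l else 0)"
    proof (cases "exp l \<le> real n \<and> real n \<le> exp l * (1 + \<delta>)")
      case True
      then have n_pos: "n > 0" using el by (cases n) auto
      have E0: "E * (ln (real n) ^ 2 * real n powr (- \<sigma>)) \<ge> 0" by (simp add: E_def)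
      show ?thesis
      proof (cases "primepow n")
        case pp: True
        have "\<not> prime n" using no_prime True by blast
        moreover have n2: "real n \<le> 2 * exp l"
        proof -
          have "exp l * (1 + \<delta>) \<le> exp l * 2" using \<delta> by (intro mult_left_mono) auto
          with True show ?thesis by linarith
        qed
        ultimately have nJ: "n \<in> J" using pp by (simp add: J_def)
        \<comment> \<open>A crude bound on \<open>ln (real n)\<close> suffices: it makes each prime
          power contribute at most \<open>(2 * l) ^ 2 / exp l\<close>.\<close>
        have "real n \<le> exp l * exp l" using el by (intro order_trans[OF n2] mult_right_mono) auto
        then have "ln (real n) \<le> ln (exp l * exp l)" using n_pos by (subst ln_le_cancel_iff) auto
        then have lnn: "ln (real n) \<le> 2 * l" by (simp add: ln_mult)
        have "\<Lambda> n * ln (real n) * real n powr (- \<sigma>) * w n \<le> ln (real n) ^ 2 * real n powr (- \<sigma>) * w n"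
          by (rule le) (simp add: w_def)
        also have "\<dots> \<le> (2 * l) ^ 2 * real n powr (- 1) * 1"
          using lnn \<sigma> n_pos l by (intro mult_mono power_mono powr_mono) (auto simp: w_def ln_nat_nonneg)
        also have "\<dots> = (2 * l) ^ 2 / real n" using n_pos by (simp add: powr_minus divide_simps)
        also have "\<dots> \<le> (2 * l) ^ 2 / exp l" using True n_pos by (intro divide_left_mono) auto
        finally show ?thesis using nJ E0 by (simp add: power_mult_distrib)
      next
        case False
        then show ?thesis using E0 by (simp add: mangoldt_def)
      qed
    next
      case False
      have "ln (real n) ^ 2 * real n powr (- \<sigma>) * w n \<le> ln (real n) ^ 2 * real n powr (- \<sigma>) * E"
      proof (cases "n = 0")
        case n0: False
        \<comment> \<open>The centre is \<open>\<delta> / 4\<close> away from the left end, and at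
          least that far from the right end because \<open>ln (1 + \<delta>) \<ge> \<delta> -
          \<delta>\<^sup>2 \<ge> \<delta> / 2\<close>.\<close>
        have "\<bar>ln (real n) - (l + \<delta> / 4)\<bar> \<ge> \<delta> / 4"
        proof (cases "exp l \<le> real n")
          case True
          with False have "exp l * (1 + \<delta>) < real n" by simp
          then have "ln (exp l * (1 + \<delta>)) < ln (real n)" using \<delta> n0 by (subst ln_less_cancel_iff) auto
          then have "l + ln (1 + \<delta>) < ln (real n)" using \<delta> by (simp add: ln_mult)
          moreover have "\<delta> - \<delta>\<^sup>2 \<le> ln (1 + \<delta>)" using \<delta> by (intro ln_one_plus_pos_lower_bound) auto
          moreover have "\<delta>\<^sup>2 \<le> \<delta> / 2" using \<delta> mult_left_mono[of \<delta> "1 / 2" \<delta>] by (simp add: power2_eq_square)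
          ultimately show ?thesis by linarith
        next
          case False
          then have "ln (real n) < ln (exp l)" using n0 by (subst ln_less_cancel_iff) auto
          then show ?thesis using \<delta> by simp
        qed
        then have "\<delta> / 4 / \<eta> \<le> \<bar>ln (real n) - (l + \<delta> / 4)\<bar> / \<eta>"
          using \<eta> by (intro divide_right_mono) auto
        then have "\<delta> / 4 / \<eta> \<le> \<bar>(ln (real n) - (l + \<delta> / 4)) / \<eta>\<bar>"
          using \<eta> by (simp add: abs_divide)
        then have "(\<delta> / 4 / \<eta>)\<^sup>2 \<le> \<bar>(ln (real n) - (l + \<delta> / 4)) / \<eta>\<bar>\<^sup>2"
          using \<delta> \<eta> by (intro power_mono) auto
        then have "(\<delta> / 4 / \<eta>)\<^sup>2 \<le> ((ln (real n) - (l + \<delta> / 4)) / \<eta>)\<^sup>2"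
          by (simp only: power2_abs)
        then have "w n \<le> E" by (simp add: w_def E_def power_divide)
        then show ?thesis by (intro mult_left_mono) auto
      qed simp
      then have "\<Lambda> n * ln (real n) * real n powr (- \<sigma>) * w n \<le> E * (ln (real n) ^ 2 * real n powr (- \<sigma>))"
        using le[of "w n"] by (simp add: w_def mult_ac)
      then show ?thesis by (simp add: add_increasing2)
    qed
  qed
  also have "\<dots> = (\<Sum>n. E * (ln (real n) ^ 2 * real n powr (- \<sigma>))) + (\<Sum>n. if n \<in> J then 4 * l\<^sup>2 / exp l else 0)"
    by (intro suminf_add [symmetric] summable_mult summable_ln_power_powr \<sigma> summable_If_finite_set J)
  also have "(\<Sum>n. E * (ln (real n) ^ 2 * real n powr (- \<sigma>))) = E * (\<Sum>n. ln (real n) ^ 2 * real n powr (- \<sigma>))"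
    by (intro suminf_mult summable_ln_power_powr \<sigma>)
  also have "(\<Sum>n. if n \<in> J then 4 * l\<^sup>2 / exp l else 0) = real (card J) * (4 * l\<^sup>2 / exp l)"
    using sums_If_finite_set[OF J(1), of "\<lambda>_. 4 * l\<^sup>2 / exp l"] by (simp add: sums_iff)
  also have "\<dots> \<le> ((2 * exp (l / 2) + 1) * (4 * l + 1)) * (4 * l\<^sup>2 / exp l)"
  proof -
    have "(exp (l / 2))\<^sup>2 = exp l" using exp_double[of "l / 2"] by simp
    then have 1: "sqrt (2 * exp l) \<le> 2 * exp (l / 2)"
      by (intro real_le_lsqrt) (simp_all add: power_mult_distrib)
    have "ln (2 * exp l) = ln 2 + l" by (simp add: ln_mult)
    then have 2: "2 * ln (2 * exp l) \<le> 4 * l" "0 \<le> 2 * ln (2 * exp l)"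
      using ln_2_less_1 l by simp_all
    have "(sqrt (2 * exp l) + 1) * (2 * ln (2 * exp l) + 1) \<le> (2 * exp (l / 2) + 1) * (4 * l + 1)"
      using 1 2 by (intro mult_mono) auto
    with J(2) show ?thesis by (intro mult_right_mono) auto
  qed
  finally show ?thesis by (simp add: w_def E_def)
qed

text \<open>All terms are non-negative, so it suffices to keep those with ln n in
  \<open>[c, c + \<eta>]\<close>, where c is the centre. Their number is at least of order
  \<open>\<eta> * exp c\<close>, and each contributes at least a constant times
  \<open>l * exp (- c)\<close>.\<close>

lemma gaussian_ln_lower:
  assumes l: "l \<ge> 3" and \<delta>: "0 < \<delta>" "\<delta> \<le> 1 / 2" and \<eta>: "0 < \<eta>" "\<eta> \<le> 1" "exp (- l) \<le> \<eta> / 4"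
    and \<sigma>: "\<sigma> = 1 + 1 / l"
  shows "(\<Sum>n. ln (real n) * real n powr (- \<sigma>) * exp (- ((ln (real n) - (l + \<delta> / 4)) / \<eta>)\<^sup>2 / 2))
    \<ge> exp (- 7 / 2) / 4 * (l * \<eta>)"
proof -
  define c where "c = l + \<delta> / 4"
  define g where "g n = ln (real n) * real n powr (- \<sigma>) * exp (- ((ln (real n) - c) / \<eta>)\<^sup>2 / 2)" for n
  define Q where "Q = {nat \<lceil>exp c\<rceil>..nat \<lfloor>exp (c + \<eta>)\<rfloor>}"
  have c: "c \<ge> l" "c + \<eta> \<le> 2 * l" using l \<delta> \<eta> by (auto simp: c_def)
  have "real (card Q) \<ge> exp (c + \<eta>) - exp c - 1"
  proof -
    have "real (nat \<lfloor>exp (c + \<eta>)\<rfloor>) = of_int \<lfloor>exp (c + \<eta>)\<rfloor>" "real (nat \<lceil>exp c\<rceil>) = of_int \<lceil>exp c\<rceil>"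
      using exp_gt_zero[of c] by (auto intro!: of_nat_nat less_imp_le simp del: exp_gt_zero)
    moreover have "real (card Q) \<ge> real (nat \<lfloor>exp (c + \<eta>)\<rfloor>) + 1 - real (nat \<lceil>exp c\<rceil>)"
      unfolding Q_def card_atLeastAtMost by linarith
    ultimately show ?thesis by linarith
  qed
  moreover have g_Q: "g n \<ge> l * exp (- (c + \<eta>)) * exp (- 7 / 2)" if "n \<in> Q" for n
  proof -
    have n: "exp c \<le> real n" "real n \<le> exp (c + \<eta>)"
      using that exp_gt_zero[of c] exp_gt_zero[of "c + \<eta>"] unfolding Q_def atLeastAtMost_iff by linarith+
    have n0: "real n > 0" using n(1) exp_gt_zero[of c] by linarith
    have ln_n: "c \<le> ln (real n)" "ln (real n) \<le> c + \<eta>"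
      using n n0 ln_le_cancel_iff[of "real n" "exp (c + \<eta>)"] by (simp_all add: ln_ge_iff)
    \<comment> \<open>Since \<open>(c + \<eta>) / l \<le> 2\<close>, the exponent
      \<open>\<sigma>\<close> in place of 1 costs only a constant factor.\<close>
    have "\<sigma> * ln (real n) \<le> (1 + 1 / l) * (c + \<eta>)"
      unfolding \<sigma> using ln_n l by (intro mult_left_mono) auto
    also have "\<dots> \<le> c + \<eta> + 3" using c l by (simp add: field_simps)
    finally have 1: "real n powr (- \<sigma>) \<ge> exp (- (c + \<eta>) - 3)" using n0 by (simp add: powr_def)
    have "((ln (real n) - c) / \<eta>)\<^sup>2 \<le> 1\<^sup>2" using ln_n \<eta> by (intro power_mono) (auto simp: divide_le_eq)
    then have 2: "exp (- ((ln (real n) - c) / \<eta>)\<^sup>2 / 2) \<ge> exp (- 1 / 2)" by simp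
    have "l * exp (- (c + \<eta>) - 3) * exp (- 1 / 2) \<le> g n"
      unfolding g_def using 1 2 ln_n c l by (intro mult_mono) auto
    also have "l * exp (- (c + \<eta>) - 3) * exp (- 1 / 2) = l * exp (- (c + \<eta>)) * exp (- 7 / 2)"
      by (simp add: mult.assoc flip: exp_add)
    finally show ?thesis .
  qed
  have "1 - exp (- \<eta>) \<ge> \<eta> / 2"
  proof -
    have "exp (- \<eta>) = 1 / exp \<eta>" by (simp add: exp_minus divide_inverse)
    also have "\<dots> \<le> 1 / (1 + \<eta>)" using \<eta> exp_ge_add_one_self[of \<eta>] by (intro divide_left_mono) (auto simp: add_pos_pos)
    also have "\<dots> \<le> 1 - \<eta> / 2" using \<eta> mult_left_mono[of \<eta> 1 \<eta>] by (simp add: field_simps)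
    finally show ?thesis by simp
  qed
  \<comment> \<open>The 1 lost by rounding to integers takes at most half of the gain
    \<open>\<eta> / 2\<close>.\<close>
  moreover have "exp (- (c + \<eta>)) \<le> \<eta> / 4"
  proof -
    have "exp (- (c + \<eta>)) \<le> exp (- l)" using c \<eta> by simp
    then show ?thesis using \<eta> by linarith
  qed
  ultimately have "\<eta> / 4 \<le> (exp (c + \<eta>) - exp c - 1) * exp (- (c + \<eta>))"
    by (simp add: left_diff_distrib flip: exp_add)
  also have "\<dots> \<le> real (card Q) * exp (- (c + \<eta>))"
    using \<open>real (card Q) \<ge> _\<close> by (intro mult_right_mono) auto
  finally have "(l * exp (- 7 / 2)) * (\<eta> / 4) \<le> (l * exp (- 7 / 2)) * (real (card Q) * exp (- (c + \<eta>)))"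
    using l by (intro mult_left_mono) auto
  also have "\<dots> = (\<Sum>n\<in>Q. l * exp (- (c + \<eta>)) * exp (- 7 / 2))" by (simp add: mult_ac)
  also have "\<dots> \<le> (\<Sum>n\<in>Q. g n)" by (intro sum_mono g_Q)
  also have "\<dots> \<le> (\<Sum>n. g n)"
  proof (rule sum_le_suminf)
    show "summable g" unfolding g_def [abs_def]
      using abs_conv_ln_power[of 1] \<sigma> l by (intro summable_gaussian_weighted) auto
  qed (auto simp: Q_def g_def ln_nat_nonneg)
  finally show ?thesis by (simp add: g_def c_def mult_ac)
qed

text \<open>At distance \<open>1 / l\<close> from the pole, the polar part
  \<open>2 / (s - 1) ^ 3\<close> of \<open>zeta_log 2\<close> has size \<open>2 * l ^ 3\<close>; the
  exponent \<theta> = 1 is good enough for the rest, as \<open>s\<close> stays bounded.\<close>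

lemma suminf_ln_square_bound:
  obtains C :: real where "C > 0"
    "\<And>l. l \<ge> 1 \<Longrightarrow> (\<Sum>n. ln (real n) ^ 2 * real n powr (- (1 + 1 / l))) \<le> C * l ^ 3"
proof -
  obtain C where C: "C > 0" "\<And>s. Re s > 1 \<Longrightarrow>
    norm (zeta_log 2 s - fact 2 / (s - 1) ^ Suc 2) \<le> C * (real 2 + norm s) powr 1"
    using zeta_log_bound[of 1 2] by auto
  have "(\<Sum>n. ln (real n) ^ 2 * real n powr (- (1 + 1 / l))) \<le> (2 + 4 * C) * l ^ 3" if l: "l \<ge> 1" for l :: real
  proof -
    define s :: complex where "s = of_real (1 + 1 / l)"
    have s: "Re s > 1" "norm s \<le> 2" using l by (auto simp: s_def simp del: of_real_add)
    have "of_real (ln (real n) ^ 2) * of_nat n powr (- s) = of_real (ln (real n) ^ 2 * real n powr (- (1 + 1 / l)))" for n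
      using powr_of_real[of "real n" "- (1 + 1 / l)"] by (simp add: s_def)
    then have "(\<lambda>n. of_real (ln (real n) ^ 2 * real n powr (- (1 + 1 / l)))) sums zeta_log 2 s"
      using sums_dser[OF abs_conv_ln_power[of 2] s(1)] by (simp only:)
    then have "(\<lambda>n. ln (real n) ^ 2 * real n powr (- (1 + 1 / l))) sums Re (zeta_log 2 s)"
      using sums_Re by fastforce
    then have "(\<Sum>n. ln (real n) ^ 2 * real n powr (- (1 + 1 / l))) \<le> norm (zeta_log 2 s)"
      using complex_Re_le_cmod by (simp add: sums_iff)
    also have "\<dots> \<le> norm (fact 2 / (s - 1) ^ Suc 2) + C * (2 + norm s)"
      using C(2)[OF s(1)] norm_triangle_sub[of "zeta_log 2 s" "fact 2 / (s - 1) ^ Suc 2"] by simp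
    also have "norm (fact 2 / (s - 1) ^ Suc 2) = 2 * l ^ 3"
    proof -
      have "s - 1 = of_real (1 / l)" by (simp add: s_def)
      then have "norm (s - 1) = 1 / l" using l by (simp only: norm_of_real) simp
      then show ?thesis by (simp add: norm_divide norm_mult norm_inverse divide_inverse fact_numeral eval_nat_numeral)
    qed
    also have "C * (2 + norm s) \<le> C * 4" using C s by simp
    also have "C * 4 \<le> C * 4 * l ^ 3" using C l by simp
    finally show ?thesis by (simp add: algebra_simps)
  qed
  moreover have "2 + 4 * C > 0" using C by simp
  ultimately show ?thesis using that by blast
qed

section \<open>Primes in short intervals\<close>

text \<open>Stated in l = ln x. The condition \<open>\<epsilon> < 1\<close> makes the relative
  length tend to 0, so that the estimates for \<open>\<delta> \<le> 1 / 2\<close> apply.\<close>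

lemma eventually_prime_in_short_interval:
  fixes \<epsilon> :: real
  assumes \<epsilon>: "0 < \<epsilon>" "\<epsilon> < 1"
  shows "eventually (\<lambda>l. \<exists>p::nat. prime p \<and> exp l \<le> real p \<and> real p \<le> exp l * (1 + l powr (- (1 - \<epsilon>)))) at_top"
proof -
  have \<epsilon>4: "0 < \<epsilon> / 4" "\<epsilon> / 4 \<le> 1" using \<epsilon> by auto
  obtain C where C: "C > 0" and mangoldt: "\<And>\<sigma> t. 1 < \<sigma> \<Longrightarrow> \<sigma> \<le> 2 \<Longrightarrow>
    norm (dser (\<lambda>n. (\<Lambda> n - 1) * ln (real n)) (Complex \<sigma> t)) \<le> C * (4 + \<bar>t\<bar>) powr (\<epsilon> / 4)"
    by (rule mangoldt_ln_bound[OF \<epsilon>4]) (rule that)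
  obtain C' :: real where C': "C' > 0"
    "\<And>l. l \<ge> 1 \<Longrightarrow> (\<Sum>n. ln (real n) ^ 2 * real n powr (- (1 + 1 / l))) \<le> C' * l ^ 3"
    using suminf_ln_square_bound by blast
  have "eventually (\<lambda>l. l powr (- (1 - \<epsilon>)) \<le> 1 / 2) at_top" using \<epsilon> by real_asymp
  moreover have "eventually (\<lambda>l. l powr (- (1 - \<epsilon> / 2)) \<le> 1) at_top" using \<epsilon> by real_asymp
  moreover have "eventually (\<lambda>l. exp (- l) \<le> l powr (- (1 - \<epsilon> / 2)) / 4) at_top" using \<epsilon> by real_asymp
  \<comment> \<open>This prepares the contradiction: the left side is of order
    \<open>l powr (\<epsilon> / 4)\<close> plus two decaying terms, the right side of order
    \<open>l powr (\<epsilon> / 2)\<close>.\<close>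
  moreover have "eventually (\<lambda>l. 6 * C * l powr (\<epsilon> / 4) + exp (- (l powr \<epsilon>) / 32) * (C' * l ^ 3) +
      (2 * exp (l / 2) + 1) * (4 * l + 1) * (4 * l\<^sup>2 / exp l) < exp (- 7 / 2) / 4 * l powr (\<epsilon> / 2)) at_top"
    using \<epsilon> C C'(1) by real_asymp
  ultimately show ?thesis using eventually_ge_at_top[of 3]
  proof eventually_elim
    case (elim l)
    define \<delta> where "\<delta> = l powr (- (1 - \<epsilon>))"
    define \<eta> where "\<eta> = l powr (- (1 - \<epsilon> / 2))"
    define \<sigma> where "\<sigma> = 1 + 1 / l"
    define w where "w n = real n powr (- \<sigma>) * exp (- ((ln (real n) - (l + \<delta> / 4)) / \<eta>)\<^sup>2 / 2)" for n
    have l: "l \<ge> 3" using elim by simp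
    have \<sigma>: "1 < \<sigma>" "\<sigma> \<le> 2" using l by (auto simp: \<sigma>_def)
    have \<delta>: "0 < \<delta>" "\<delta> \<le> 1 / 2" and \<eta>: "0 < \<eta>" "\<eta> \<le> 1" "exp (- l) \<le> \<eta> / 4"
      using elim by (auto simp: \<delta>_def \<eta>_def)
    show ?case
    proof (rule ccontr)
      assume "\<not> ?case"
      then have no_prime: "\<not> (exp l \<le> real p \<and> real p \<le> exp l * (1 + \<delta>))" if "prime p" for p :: nat
        using that by (auto simp: \<delta>_def)
      have a1: "abs_conv (\<lambda>n. (\<Lambda> n - 1) * ln (real n))"
        using abs_conv_diff[OF abs_conv_mangoldt_ln abs_conv_ln_power[of 1]] by (simp add: left_diff_distrib)
      have a2: "abs_conv (\<lambda>n. ln (real n))" using abs_conv_ln_power[of 1] by simp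
      have s1: "summable (\<lambda>n. (\<Lambda> n - 1) * ln (real n) * w n)"
        using summable_gaussian_weighted[OF a1 \<sigma>(1), of "l + \<delta> / 4" \<eta>] by (simp add: w_def mult.assoc)
      have s2: "summable (\<lambda>n. ln (real n) * w n)"
        using summable_gaussian_weighted[OF a2 \<sigma>(1), of "l + \<delta> / 4" \<eta>] by (simp add: w_def mult.assoc)
      have "\<bar>\<Sum>n. (\<Lambda> n - 1) * ln (real n) * w n\<bar> \<le> 6 * C * \<eta> powr (- (\<epsilon> / 4))"
        using gaussian_sum_bound[OF a1 \<sigma>(1) \<eta>(1,2) _ _ _ mangoldt[OF \<sigma>], of "l + \<delta> / 4"] \<epsilon> C
        by (simp add: w_def mult.assoc)
      also have "\<eta> powr (- (\<epsilon> / 4)) = l powr ((1 - \<epsilon> / 2) * (\<epsilon> / 4))" by (simp only: \<eta>_def powr_powr minus_mult_minus)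
      also have "\<dots> \<le> l powr (1 * (\<epsilon> / 4))" using \<epsilon> l by (intro powr_mono mult_right_mono) auto
      finally have 1: "\<bar>\<Sum>n. (\<Lambda> n - 1) * ln (real n) * w n\<bar> \<le> 6 * C * l powr (\<epsilon> / 4)"
        using C by simp
      have "l * \<eta> = l powr 1 * \<eta>" using l by simp
      also have "\<dots> = l powr (\<epsilon> / 2)" unfolding \<eta>_def powr_add [symmetric] by simp
      finally have l\<eta>: "l * \<eta> = l powr (\<epsilon> / 2)" .
      have 2: "(\<Sum>n. ln (real n) * w n) \<ge> exp (- 7 / 2) / 4 * l powr (\<epsilon> / 2)"
        using gaussian_ln_lower[OF l \<delta> \<eta> \<sigma>_def] by (simp add: w_def mult.assoc l\<eta>)
      \<comment> \<open>The smoothing is narrower than the interval by the factor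
        \<open>l powr (\<epsilon> / 2)\<close>, which is what makes the weight outside
        negligible.\<close>
      have "(\<delta> / \<eta>)\<^sup>2 = (l powr (\<epsilon> / 2))\<^sup>2"
        unfolding \<delta>_def \<eta>_def powr_diff [symmetric] by simp
      also have "\<dots> = l powr \<epsilon>" by (simp add: power2_eq_square flip: powr_add)
      finally have \<delta>\<eta>: "(\<delta> / \<eta>)\<^sup>2 = l powr \<epsilon>" .
      have "(\<Sum>n. \<Lambda> n * ln (real n) * w n) \<le> exp (- (l powr \<epsilon>) / 32) * (\<Sum>n. ln (real n) ^ 2 * real n powr (- \<sigma>))
        + (2 * exp (l / 2) + 1) * (4 * l + 1) * (4 * l\<^sup>2 / exp l)"
        using gaussian_mangoldt_upper[OF l \<delta> \<eta>(1) \<sigma>(1) no_prime] unfolding \<delta>\<eta> by (simp add: w_def mult.assoc)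
      also have "exp (- (l powr \<epsilon>) / 32) * (\<Sum>n. ln (real n) ^ 2 * real n powr (- \<sigma>)) \<le> exp (- (l powr \<epsilon>) / 32) * (C' * l ^ 3)"
        using C'(2)[of l] l by (intro mult_left_mono) (auto simp: \<sigma>_def)
      finally have 3: "(\<Sum>n. \<Lambda> n * ln (real n) * w n) \<le> exp (- (l powr \<epsilon>) / 32) * (C' * l ^ 3)
        + (2 * exp (l / 2) + 1) * (4 * l + 1) * (4 * l\<^sup>2 / exp l)" by simp
      \<comment> \<open>Writing \<Lambda> as (\<Lambda> - 1) + 1 shows that the lower bound
        \<open>2\<close> is at most the sum of the upper bounds \<open>1\<close> and
        \<open>3\<close>, which \<open>elim(4)\<close> contradicts.\<close>
      have "(\<Sum>n. \<Lambda> n * ln (real n) * w n) = (\<Sum>n. (\<Lambda> n - 1) * ln (real n) * w n + ln (real n) * w n)"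
        by (simp add: algebra_simps)
      also have "\<dots> = (\<Sum>n. (\<Lambda> n - 1) * ln (real n) * w n) + (\<Sum>n. ln (real n) * w n)"
        by (intro suminf_add [symmetric] s1 s2)
      finally show False using 1 2 3 elim(4) by linarith
    qed
  qed
qed

theorem theorem48:
  fixes \<epsilon> :: real
  assumes "\<epsilon> > 0"
  shows "\<exists>x0::real. \<forall>x y::real. x \<ge> x0 \<longrightarrow> y \<ge> x / (ln x) powr (1 - \<epsilon>) \<longrightarrow>
           (\<exists>p::nat. prime p \<and> x \<le> real p \<and> real p \<le> x + y)"
proof -
  \<comment> \<open>Reduction to exponents below 1: once \<open>ln x \<ge> 1\<close>, a larger
    \<open>\<epsilon>\<close> only lengthens the interval.\<close>
  define \<epsilon>' where "\<epsilon>' = min \<epsilon> (1 / 2)"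
  have \<epsilon>': "0 < \<epsilon>'" "\<epsilon>' < 1" "\<epsilon>' \<le> \<epsilon>" using assms by (auto simp: \<epsilon>'_def)
  obtain l0 where l0: "\<And>l. l \<ge> l0 \<Longrightarrow>
      \<exists>p::nat. prime p \<and> exp l \<le> real p \<and> real p \<le> exp l * (1 + l powr (- (1 - \<epsilon>')))"
    using eventually_prime_in_short_interval[OF \<epsilon>'(1,2)] unfolding eventually_at_top_linorder by blast
  show ?thesis
  proof (intro exI[of _ "exp (max l0 1)"] allI impI)
    fix x y :: real
    assume x: "x \<ge> exp (max l0 1)" and y: "y \<ge> x / (ln x) powr (1 - \<epsilon>)"
    have x0: "x > 0" using x exp_gt_zero[of "max l0 1"] by linarith
    have ln_x: "ln x \<ge> max l0 1" using x by (subst ln_ge_iff[OF x0])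
    obtain p :: nat where p: "prime p" "x \<le> real p" "real p \<le> x * (1 + ln x powr (- (1 - \<epsilon>')))"
      using l0[of "ln x"] ln_x x0 by auto
    have "x * ln x powr (- (1 - \<epsilon>')) \<le> x * ln x powr (- (1 - \<epsilon>))"
      using x0 ln_x \<epsilon>' by (intro mult_left_mono powr_mono) auto
    also have "\<dots> = x / (ln x) powr (1 - \<epsilon>)" by (simp only: powr_minus divide_inverse)
    finally have "real p \<le> x + y" using p y by (simp add: ring_distribs)
    with p show "\<exists>p::nat. prime p \<and> x \<le> real p \<and> real p \<le> x + y" by blast
  qed
qed

end
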